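(* Let $\ell$ be a conditionally orthogonal loss that is $\alpha$-strongly convex, i.e. $\mathbb{E}[\partial^2\ell(v,g;Z)\mid X]\ge\alpha$ for any $v\in\mathbb{R}$, $g\in\mathcal{G}$, and $\beta$-smooth, i.e. $\mathbb{E}[\partial^2\ell(v,g;Z)\mid X]\le\beta$ for any $v\in\mathbb{R}$, $g\in\mathcal{G}$ (with $\alpha,\beta>0$). Suppose $D_g^2\,\mathbb{E}[\partial\ell(\gamma_\theta^*,f;Z)\mid X](g-g_\theta,g-g_\theta)$ exists for all $f,g\in\mathcal{G}$. Then, for any $\theta:\mathcal{X}\to\mathbb{R}$ and any nuisance $g=(\eta,\zeta)\in\mathcal{G}$, $$\mathrm{Cal}(\theta,\eta_0)\le\frac{\beta}{2\alpha}\,\mathrm{err}(g,g_\theta;\gamma_\theta^* )+\frac{\beta}{\alpha}\,\mathrm{Cal}(\theta,g),$$ where $g_\theta=(\eta_0,\zeta_\theta)$ are the true nuisance functions and $\gamma_\theta^*$ is the true calibration function associated with $\theta$.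
   Context: Setting: $Z$ is a random element of a space $\mathcal{Z}$ with distribution $P_Z$; $X$ (covariates, in $\mathcal{X}$) and $W$ (extended variables, in $\mathcal{W}$) are sub-vectors of $Z$, with $X$ a sub-vector of $W$, and $P_X,P_W$ are their marginal laws. $\mathcal{G}\subset L^2(\mathcal{W},P_W)$ is a space of vector-valued nuisance functions on $\mathcal{W}$, here pairs $g=(\eta,\zeta)$. Notation: for $\theta:\mathcal{X}\to\mathbb{R}$, $\ell(\theta,g;z)$ abbreviates $\ell(\theta(x),g;z)$; $\partial\ell(\theta,g;z):=\frac{\partial}{\partial\nu}\ell(\nu,g;z)\big|_{\nu=\theta(x)}$, and $\partial^2\ell$ is the second such partial derivative. $D_gT(f)(h)$, $D_g^2T(f)(h,h)$ are the first and second Gateaux derivatives at $f$ in direction $h$ (first and second derivatives in $t$ of $T(f+th)$ at $t=0$). For $f,h\in\mathcal{G}$, $[f,h]:=\{w\mapsto\lambda(w)f(w)+(1-\lambda(w))h(w):\lambda(w)\in[0,1]\}$, and for $\varphi:\mathcal{X}\to\mathbb{R}$ $$\mathrm{err}(g,h;\varphi):=\sup_{f\in[g,h]}\sqrt{\mathbb{E}\Big(\big\{D_g^2\,\mathbb{E}[\partial\ell(\varphi,f;Z)\mid X](h-g,h-g)\big\}^2\Big)}.$$ Conditional orthogonality: there is an initial loss $\widetilde\ell(\nu,\eta;z)$ with true nuisance $\eta_0$, and $\ell(\theta,(\eta,\zeta);z):=\widetilde\ell(\theta,\eta;z)-\theta(x)\cdot\mathrm{Corr}((\eta,\zeta);z)$,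 where $\mathrm{Corr}$ satisfies $\mathbb{E}[\mathrm{Corr}((\eta_0,\zeta);Z)\mid X]=0$ for every $\zeta$. The loss $\ell$ is conditionally orthogonal if for any $\varphi:\mathcal{X}\to\mathbb{R}$ there exists $\zeta_\varphi\in L^2(P_X)$ such that $D_g\,\mathbb{E}[\partial\ell(\gamma_\varphi^*,g_\varphi;Z)\mid\varphi(X)](g-g_\varphi)=0$ for all $g\in\mathcal{G}$, where $g_\varphi:=(\eta_0,\zeta_\varphi)$. Calibration function: $\gamma_\varphi(x;g):=\arg\min_\nu\mathbb{E}[\ell(\nu,g;Z)\mid\varphi(X)=\varphi(x)]$. For $\eta=\eta_0$ this does not depend on $\zeta$, and $\gamma_\varphi^*(x):=\gamma_\varphi(x;(\eta_0,\zeta))$ (any $\zeta$) is the true calibration function. $L^2$ calibration error: $\mathrm{Cal}(\theta,g):=\mathbb{E}\big(\mathbb{E}[\partial\ell(\theta,g;Z)\mid\theta(X)]^2\big)^{1/2}$. It does not depend on $\zeta$ when $\eta=\eta_0$, and $\mathrm{Cal}(\theta,\eta_0)$ denotes $\mathrm{Cal}(\theta,(\eta_0,\zeta))$ for any $\zeta$.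
   Formalization: Added regularity: the derivative in ν commutes with conditional expectation, for ∂ℓ given X and for ℓ given θ(X); the scores at θ and γ* are integrable, regular conditional distributions exist, and [g,g_θ] lies in G. Without the interchange the bound can fail. *)

theory Defs
  imports "HOL-Probability.Probability"
begin

text \<open>
  The measure \<open>P\<close> is the law of \<open>Z\<close>, and every random variable is a measurable function
  of \<open>z\<close>.  Derivatives in \<open>\<nu>\<close> or in the nuisance, and minimisation over \<open>\<nu>\<close>, are applied
  to conditional expectations pointwise in the conditioning value.  For this the versions must be
  chosen coherently in the parameter, so conditional expectations given \<open>Y\<close> are integrals
  against a regular conditional distribution \<open>\<kappa>\<close> of \<open>Z\<close> given \<open>Y\<close>.
\<close>

definition regular_cond_dist ::
    "'z measure \<Rightarrow> ('z \<Rightarrow> 'y) \<Rightarrow> 'y measure \<Rightarrow> ('y \<Rightarrow> 'z measure) \<Rightarrow> bool" where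
  "regular_cond_dist P Y N \<kappa> \<longleftrightarrow>
     Y \<in> P \<rightarrow>\<^sub>M N \<and> \<kappa> \<in> N \<rightarrow>\<^sub>M prob_algebra P \<and>
     (\<forall>A\<in>sets P. AE z in P.
        measure (\<kappa> (Y z)) A
          = real_cond_exp P (vimage_algebra (space P) Y N) (indicator A) z)"

text \<open>\<open>cond_mean \<kappa> f y\<close> is \<open>\<bbbE>[f(Z) | Y = y]\<close>.\<close>

definition cond_mean :: "('y \<Rightarrow> 'z measure) \<Rightarrow> ('z \<Rightarrow> real) \<Rightarrow> 'y \<Rightarrow> real" where
  "cond_mean \<kappa> f y = (\<integral>z. f z \<partial>\<kappa> y)"

text \<open>The value is infinite when \<open>f\<close> is not square integrable.\<close>

definition L2_norm :: "'a measure \<Rightarrow> ('a \<Rightarrow> real) \<Rightarrow> ennreal" where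
  "L2_norm M f =
     (let S = (\<integral>\<^sup>+ x. ennreal ((f x)\<^sup>2) \<partial>M)
      in if S = \<infinity> then \<infinity> else ennreal (sqrt (enn2real S)))"

definition in_L2 :: "'a measure \<Rightarrow> ('a \<Rightarrow> 'b::euclidean_space) \<Rightarrow> bool" where
  "in_L2 M f \<longleftrightarrow> f \<in> borel_measurable M \<and> integrable M (\<lambda>x. (norm (f x))\<^sup>2)"

definition pair_fun :: "('w \<Rightarrow> 'b) \<Rightarrow> ('w \<Rightarrow> 'c) \<Rightarrow> 'w \<Rightarrow> 'b \<times> 'c" where
  "pair_fun \<eta> \<zeta> = (\<lambda>w. (\<eta> w, \<zeta> w))"

text \<open>
  The weight \<open>c\<close> is required to be measurable, since otherwise the segment between two elements
  of \<open>L\<^sup>2\<close> would not consist of measurable functions.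
\<close>

definition fun_segment ::
    "'w measure \<Rightarrow> ('w \<Rightarrow> 'v::real_vector) \<Rightarrow> ('w \<Rightarrow> 'v) \<Rightarrow> ('w \<Rightarrow> 'v) set" where
  "fun_segment MW f h =
     {(\<lambda>w. c w *\<^sub>R f w + (1 - c w) *\<^sub>R h w) | c.
        c \<in> borel_measurable MW \<and> (\<forall>w. 0 \<le> c w \<and> c w \<le> (1::real))}"


subsection \<open>Losses\<close>

text \<open>
  A loss may depend on the nuisance as a whole function, not only on its value at one point.
\<close>

type_synonym ('g, 'z) loss = "real \<Rightarrow> 'g \<Rightarrow> 'z \<Rightarrow> real"

definition corrected_loss ::
    "('w \<Rightarrow> 'b, 'z) loss \<Rightarrow> (('w \<Rightarrow> 'b \<times> 'c) \<Rightarrow> 'z \<Rightarrow> real) \<Rightarrow> ('w \<Rightarrow> 'b \<times> 'c, 'z) loss" where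
  "corrected_loss l0 Corr \<nu> g z = l0 \<nu> (fst \<circ> g) z - \<nu> * Corr g z"

definition d_loss :: "('g, 'z) loss \<Rightarrow> ('g, 'z) loss" where
  "d_loss l \<nu> g z = deriv (\<lambda>v. l v g z) \<nu>"

definition d2_loss :: "('g, 'z) loss \<Rightarrow> ('g, 'z) loss" where
  "d2_loss l \<nu> g z = deriv (\<lambda>v. d_loss l v g z) \<nu>"

definition twice_differentiable_loss ::
    "'z measure \<Rightarrow> 'g set \<Rightarrow> ('g, 'z) loss \<Rightarrow> bool" where
  "twice_differentiable_loss P G l \<longleftrightarrow>
     (\<forall>g\<in>G. \<forall>z\<in>space P. \<forall>\<nu>.
        (\<lambda>v. l v g z) field_differentiable at \<nu> \<and>
        (\<lambda>v. d_loss l v g z) field_differentiable at \<nu>)"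

text \<open>
  For almost every \<open>y\<close>, \<open>\<bbbE>[F(\<nu>, Z) | Y = y]\<close> and \<open>\<bbbE>[\<partial>F(\<nu>, Z) | Y = y]\<close> exist for
  all \<open>\<nu>\<close> and the second is the derivative in \<open>\<nu>\<close> of the first.
\<close>

definition diff_under_cond_mean ::
    "'z measure \<Rightarrow> ('z \<Rightarrow> 'y) \<Rightarrow> 'y measure \<Rightarrow> ('y \<Rightarrow> 'z measure)
      \<Rightarrow> (real \<Rightarrow> 'z \<Rightarrow> real) \<Rightarrow> bool" where
  "diff_under_cond_mean P Y N \<kappa> F \<longleftrightarrow>
     (AE y in distr P N Y. \<forall>\<nu>.
        integrable (\<kappa> y) (F \<nu>) \<and>
        integrable (\<kappa> y) (\<lambda>z. deriv (\<lambda>v. F v z) \<nu>) \<and>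
        ((\<lambda>v. cond_mean \<kappa> (F v) y)
           has_real_derivative cond_mean \<kappa> (\<lambda>z. deriv (\<lambda>v. F v z) \<nu>) y) (at \<nu>))"

definition strongly_convex_loss ::
    "'z measure \<Rightarrow> ('z \<Rightarrow> 'x) \<Rightarrow> 'x measure \<Rightarrow> ('x \<Rightarrow> 'z measure) \<Rightarrow> 'g set
      \<Rightarrow> ('g, 'z) loss \<Rightarrow> real \<Rightarrow> bool" where
  "strongly_convex_loss P X MX KX G l \<alpha> \<longleftrightarrow>
     (\<forall>v. \<forall>g\<in>G. AE x in distr P MX X. cond_mean KX (d2_loss l v g) x \<ge> \<alpha>)"

definition smooth_loss ::
    "'z measure \<Rightarrow> ('z \<Rightarrow> 'x) \<Rightarrow> 'x measure \<Rightarrow> ('x \<Rightarrow> 'z measure) \<Rightarrow> 'g set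
      \<Rightarrow> ('g, 'z) loss \<Rightarrow> real \<Rightarrow> bool" where
  "smooth_loss P X MX KX G l \<beta> \<longleftrightarrow>
     (\<forall>v. \<forall>g\<in>G. AE x in distr P MX X. cond_mean KX (d2_loss l v g) x \<le> \<beta>)"


subsection \<open>Gateaux derivatives\<close>

definition line_fun :: "('w \<Rightarrow> 'v::real_vector) \<Rightarrow> ('w \<Rightarrow> 'v) \<Rightarrow> real \<Rightarrow> 'w \<Rightarrow> 'v" where
  "line_fun f h t = (\<lambda>w. f w + t *\<^sub>R h w)"

definition has_gateaux_derivative ::
    "(('w \<Rightarrow> 'v::real_vector) \<Rightarrow> real) \<Rightarrow> ('w \<Rightarrow> 'v) \<Rightarrow> ('w \<Rightarrow> 'v) \<Rightarrow> real \<Rightarrow> bool" where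
  "has_gateaux_derivative T f h D \<longleftrightarrow>
     ((\<lambda>t. T (line_fun f h t)) has_real_derivative D) (at 0)"

definition gateaux2_exists ::
    "(('w \<Rightarrow> 'v::real_vector) \<Rightarrow> real) \<Rightarrow> ('w \<Rightarrow> 'v) \<Rightarrow> ('w \<Rightarrow> 'v) \<Rightarrow> bool" where
  "gateaux2_exists T f h \<longleftrightarrow>
     (\<forall>\<^sub>F t in nhds 0. (\<lambda>s. T (line_fun f h s)) field_differentiable at t) \<and>
     deriv (\<lambda>s. T (line_fun f h s)) field_differentiable at 0"

definition gateaux2 ::
    "(('w \<Rightarrow> 'v::real_vector) \<Rightarrow> real) \<Rightarrow> ('w \<Rightarrow> 'v) \<Rightarrow> ('w \<Rightarrow> 'v) \<Rightarrow> real" where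
  "gateaux2 T f h = deriv (deriv (\<lambda>s. T (line_fun f h s))) 0"


subsection \<open>Score, nuisance error, calibration\<close>

text \<open>
  \<open>cond_score X \<kappa> l \<phi> f y\<close> is \<open>\<bbbE>[\<partial>\<ell>(\<phi>, f; Z) | Y = y]\<close>, where \<open>\<kappa>\<close> is the
  conditional distribution of \<open>Z\<close> given \<open>Y\<close>; here \<open>Y\<close> is \<open>X\<close> or a function of \<open>X\<close>.
\<close>

definition cond_score ::
    "('z \<Rightarrow> 'x) \<Rightarrow> ('y \<Rightarrow> 'z measure) \<Rightarrow> ('g, 'z) loss \<Rightarrow> ('x \<Rightarrow> real) \<Rightarrow> 'g \<Rightarrow> 'y \<Rightarrow> real" where
  "cond_score X \<kappa> l \<phi> f y = cond_mean \<kappa> (\<lambda>z. d_loss l (\<phi> (X z)) f z) y"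

text \<open>
  Existence of \<open>D\<^sub>g\<^sup>2 \<bbbE>[\<partial>\<ell>(\<phi>, f; Z) | X](h, h)\<close>.  The exceptional null set of
  values of \<open>X\<close> is common to the part of the line \<open>f + \<real>h\<close> that lies in \<open>G\<close>, but it may
  depend on that line; a null set depending on each point of the line separately would not
  give a twice differentiable function of \<open>t\<close> for any single value of \<open>X\<close>.
\<close>

definition gateaux2_exists_along ::
    "'z measure \<Rightarrow> ('z \<Rightarrow> 'x) \<Rightarrow> 'x measure \<Rightarrow> ('x \<Rightarrow> 'z measure) \<Rightarrow> ('w \<Rightarrow> 'v::real_vector) set
      \<Rightarrow> ('w \<Rightarrow> 'v, 'z) loss \<Rightarrow> ('x \<Rightarrow> real) \<Rightarrow> ('w \<Rightarrow> 'v) \<Rightarrow> ('w \<Rightarrow> 'v) \<Rightarrow> bool" where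
  "gateaux2_exists_along P X MX KX G l \<phi> f h \<longleftrightarrow>
     (AE x in distr P MX X. \<forall>t. line_fun f h t \<in> G \<longrightarrow>
        gateaux2_exists (\<lambda>f'. cond_score X KX l \<phi> f' x) (line_fun f h t) h)"

definition nuisance_err ::
    "'z measure \<Rightarrow> 'w measure \<Rightarrow> ('z \<Rightarrow> 'x) \<Rightarrow> ('x \<Rightarrow> 'z measure)
      \<Rightarrow> ('w \<Rightarrow> 'v::real_vector, 'z) loss \<Rightarrow> ('w \<Rightarrow> 'v) \<Rightarrow> ('w \<Rightarrow> 'v) \<Rightarrow> ('x \<Rightarrow> real) \<Rightarrow> ennreal" where
  "nuisance_err P MW X KX l g h \<phi> =
     (SUP f\<in>fun_segment MW g h.
        L2_norm P (\<lambda>z. gateaux2 (\<lambda>f'. cond_score X KX l \<phi> f' (X z)) f (\<lambda>w. h w - g w)))"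

text \<open>
  From here on \<open>K \<phi>\<close> stands for the conditional distribution of \<open>Z\<close> given \<open>\<phi>(X)\<close>.
\<close>

definition cal_error ::
    "'z measure \<Rightarrow> ('z \<Rightarrow> 'x) \<Rightarrow> (('x \<Rightarrow> real) \<Rightarrow> real \<Rightarrow> 'z measure)
      \<Rightarrow> ('g, 'z) loss \<Rightarrow> ('x \<Rightarrow> real) \<Rightarrow> 'g \<Rightarrow> ennreal" where
  "cal_error P X K l \<theta> g = L2_norm P (\<lambda>z. cond_score X (K \<theta>) l \<theta> g (\<theta> (X z)))"

text \<open>
  \<open>\<gamma>\<close> is a version of \<open>\<gamma>\<^sub>\<phi>(\<cdot>; g)\<close>: a measurable function of \<open>\<phi>(x)\<close> that
  attains the minimum for almost every \<open>x\<close>.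
\<close>

definition calibration_fun ::
    "'z measure \<Rightarrow> ('z \<Rightarrow> 'x) \<Rightarrow> 'x measure \<Rightarrow> (('x \<Rightarrow> real) \<Rightarrow> real \<Rightarrow> 'z measure)
      \<Rightarrow> ('g, 'z) loss \<Rightarrow> ('x \<Rightarrow> real) \<Rightarrow> 'g \<Rightarrow> ('x \<Rightarrow> real) \<Rightarrow> bool" where
  "calibration_fun P X MX K l \<phi> g \<gamma> \<longleftrightarrow>
     (\<exists>c\<in>borel_measurable borel. \<gamma> = c \<circ> \<phi>) \<and>
     (AE x in distr P MX X.
        is_arg_min (\<lambda>\<nu>. cond_mean (K \<phi>) (l \<nu> g) (\<phi> x)) (\<lambda>_. True) (\<gamma> x))"

text \<open>
  For \<open>\<eta> = \<eta>\<^sub>0\<close> the minimiser does not depend on \<open>\<zeta>\<close>, so any admissible \<open>\<zeta>\<close> serves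
  to define the true calibration function.
\<close>

definition true_calibration_fun ::
    "'z measure \<Rightarrow> ('z \<Rightarrow> 'x) \<Rightarrow> 'x measure \<Rightarrow> (('x \<Rightarrow> real) \<Rightarrow> real \<Rightarrow> 'z measure)
      \<Rightarrow> ('w \<Rightarrow> 'b \<times> 'c) set \<Rightarrow> ('w \<Rightarrow> 'b \<times> 'c, 'z) loss \<Rightarrow> ('w \<Rightarrow> 'b)
      \<Rightarrow> ('x \<Rightarrow> real) \<Rightarrow> ('x \<Rightarrow> real) \<Rightarrow> bool" where
  "true_calibration_fun P X MX K G l \<eta>0 \<phi> \<gamma> \<longleftrightarrow>
     (\<exists>\<zeta>. pair_fun \<eta>0 \<zeta> \<in> G \<and> calibration_fun P X MX K l \<phi> (pair_fun \<eta>0 \<zeta>) \<gamma>)"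

definition centred_correction ::
    "'z measure \<Rightarrow> ('z \<Rightarrow> 'x) \<Rightarrow> 'x measure \<Rightarrow> ('x \<Rightarrow> 'z measure) \<Rightarrow> ('w \<Rightarrow> 'b \<times> 'c) set
      \<Rightarrow> ('w \<Rightarrow> 'b) \<Rightarrow> (('w \<Rightarrow> 'b \<times> 'c) \<Rightarrow> 'z \<Rightarrow> real) \<Rightarrow> bool" where
  "centred_correction P X MX KX G \<eta>0 Corr \<longleftrightarrow>
     (\<forall>\<zeta>. pair_fun \<eta>0 \<zeta> \<in> G \<longrightarrow>
        integrable P (Corr (pair_fun \<eta>0 \<zeta>)) \<and>
        (AE x in distr P MX X. cond_mean KX (Corr (pair_fun \<eta>0 \<zeta>)) x = 0))"

text \<open>
  \<open>prX\<close> extracts the covariates from the extended variables, so \<open>\<zeta> \<circ> prX\<close> is the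
  function \<open>\<zeta>\<close> of \<open>x\<close> regarded as a function on the extended variables.
\<close>

definition orthogonal_at ::
    "'z measure \<Rightarrow> ('z \<Rightarrow> 'x) \<Rightarrow> 'x measure \<Rightarrow> ('w \<Rightarrow> 'x) \<Rightarrow> (('x \<Rightarrow> real) \<Rightarrow> real \<Rightarrow> 'z measure)
      \<Rightarrow> ('w \<Rightarrow> 'b \<times> 'c) set \<Rightarrow> ('w \<Rightarrow> 'b::euclidean_space \<times> 'c::euclidean_space, 'z) loss
      \<Rightarrow> ('w \<Rightarrow> 'b) \<Rightarrow> ('x \<Rightarrow> real) \<Rightarrow> ('x \<Rightarrow> 'c) \<Rightarrow> bool" where
  "orthogonal_at P X MX prX K G l \<eta>0 \<phi> \<zeta> \<longleftrightarrow>
     in_L2 (distr P MX X) \<zeta> \<and>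
     pair_fun \<eta>0 (\<zeta> \<circ> prX) \<in> G \<and>
     (\<forall>\<gamma>. true_calibration_fun P X MX K G l \<eta>0 \<phi> \<gamma> \<longrightarrow>
       (\<forall>g\<in>G. AE r in distr P borel (\<phi> \<circ> X).
          has_gateaux_derivative (\<lambda>f. cond_score X (K \<phi>) l \<gamma> f r)
            (pair_fun \<eta>0 (\<zeta> \<circ> prX)) (\<lambda>w. g w - pair_fun \<eta>0 (\<zeta> \<circ> prX) w) 0))"

definition conditionally_orthogonal ::
    "'z measure \<Rightarrow> ('z \<Rightarrow> 'x) \<Rightarrow> 'x measure \<Rightarrow> ('w \<Rightarrow> 'x) \<Rightarrow> (('x \<Rightarrow> real) \<Rightarrow> real \<Rightarrow> 'z measure)
      \<Rightarrow> ('w \<Rightarrow> 'b \<times> 'c) set \<Rightarrow> ('w \<Rightarrow> 'b::euclidean_space \<times> 'c::euclidean_space, 'z) loss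
      \<Rightarrow> ('w \<Rightarrow> 'b) \<Rightarrow> bool" where
  "conditionally_orthogonal P X MX prX K G l \<eta>0 \<longleftrightarrow>
     (\<forall>\<phi>\<in>borel_measurable MX. \<exists>\<zeta>. orthogonal_at P X MX prX K G l \<eta>0 \<phi> \<zeta>)"

end

theory Submission
  imports Defs
begin

text \<open>
  Write \<open>C f\<close> and \<open>E f\<close> for \<open>\<bbbE>[\<partial>\<ell>(\<theta>, f; Z) | \<theta>(X)]\<close> and \<open>\<bbbE>[\<partial>\<ell>(\<gamma>, f; Z) | \<theta>(X)]\<close>.  As \<open>\<theta> - \<gamma>\<close> is a function
  of \<open>\<theta>(X)\<close>, convexity and smoothness give \<open>\<alpha>|\<theta> - \<gamma>| \<le> |C f - E f| \<le> \<beta>|\<theta> - \<gamma>|\<close>.  Optimality of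
  \<open>\<gamma>\<close> means \<open>E g\<theta> = 0\<close>, so \<open>|C g\<theta>| \<le> \<beta>|\<theta> - \<gamma>| \<le> (\<beta>/\<alpha>)(|C g| + |E g|)\<close>, and it remains to bound
  \<open>E g\<close> in \<open>L\<^sup>2\<close> by half the nuisance error.  For this let \<open>u(t)\<close> be the conditional score given
  \<open>X\<close> at \<open>\<gamma>\<close> and \<open>g\<theta> + t(g - g\<theta>)\<close>.  The remainder \<open>u(t) - u(0) - t u'(0) = \<integral>\<^sub>0\<^sup>t (t - s) u''(s) ds\<close> has
  \<open>L\<^sup>2\<close> norm at most \<open>t\<^sup>2/2\<close> times the nuisance error.  Orthogonality concerns the derivative of
  \<open>\<bbbE>[u(t) | \<theta>(X)]\<close>; the remainder bound and Fatou's lemma turn it into \<open>\<bbbE>[u'(0) | \<theta>(X)] = 0\<close>, and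
  conditioning the expansion at \<open>t = 1\<close> on \<open>\<theta>(X)\<close> gives the bound.
\<close>

subsection \<open>Regular conditional distributions\<close>

lemma regular_cond_distD:
  assumes "regular_cond_dist P Y N \<kappa>"
  shows "Y \<in> P \<rightarrow>\<^sub>M N" "\<kappa> \<in> N \<rightarrow>\<^sub>M prob_algebra P" "\<kappa> \<in> N \<rightarrow>\<^sub>M subprob_algebra P"
    and "\<And>A. A \<in> sets P \<Longrightarrow>
      AE z in P. measure (\<kappa> (Y z)) A
        = real_cond_exp P (vimage_algebra (space P) Y N) (indicator A) z"
    and "\<And>z. z \<in> space P \<Longrightarrow> sets (\<kappa> (Y z)) = sets P"
    and "\<And>z. z \<in> space P \<Longrightarrow> prob_space (\<kappa> (Y z))"
proof -
  show Y: "Y \<in> P \<rightarrow>\<^sub>M N" and K: "\<kappa> \<in> N \<rightarrow>\<^sub>M prob_algebra P"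
    and "\<And>A. A \<in> sets P \<Longrightarrow>
      AE z in P. measure (\<kappa> (Y z)) A
        = real_cond_exp P (vimage_algebra (space P) Y N) (indicator A) z"
    using assms unfolding regular_cond_dist_def by auto
  show "\<kappa> \<in> N \<rightarrow>\<^sub>M subprob_algebra P" using K by (rule measurable_prob_algebraD)
  have "\<kappa> (Y z) \<in> space (prob_algebra P)" if "z \<in> space P" for z
    using measurable_space[OF K] measurable_space[OF Y that] by auto
  then show "\<And>z. z \<in> space P \<Longrightarrow> sets (\<kappa> (Y z)) = sets P"
    "\<And>z. z \<in> space P \<Longrightarrow> prob_space (\<kappa> (Y z))"
    by (auto simp: space_prob_algebra)
qed

lemma subalgebra_vimage_algebra:
  assumes "Y \<in> P \<rightarrow>\<^sub>M N"
  shows "subalgebra P (vimage_algebra (space P) Y N)"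
  using assms unfolding subalgebra_def
  by (auto simp: sets_vimage_algebra2[OF measurable_space[OF assms, THEN Pi_I]] measurable_sets)

lemma finite_measure_subalgebra_vimage:
  assumes "prob_space P" "Y \<in> P \<rightarrow>\<^sub>M N"
  shows "finite_measure_subalgebra P (vimage_algebra (space P) Y N)"
proof -
  interpret prob_space P by fact
  show ?thesis
    by unfold_locales (rule subalgebra_vimage_algebra[OF assms(2)])
qed

lemma measurable_comp_vimage_algebra:
  assumes "Y \<in> P \<rightarrow>\<^sub>M N" "h \<in> N \<rightarrow>\<^sub>M L"
  shows "(\<lambda>z. h (Y z)) \<in> vimage_algebra (space P) Y N \<rightarrow>\<^sub>M L"
  using measurable_comp[OF measurable_vimage_algebra1[OF measurable_space[OF assms(1), THEN Pi_I]] assms(2)]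
  by (simp add: comp_def)

text \<open>The definition of a regular conditional distribution speaks of indicators only.
  Restricting \<open>P\<close> to an event \<open>B\<close> determined by \<open>Y\<close> gives a
  measure that is reproduced by mixing \<open>\<kappa> (Y z)\<close> over it. As an identity of
  measures this covers every nonnegative \<open>F\<close> at once, and letting \<open>B\<close> vary
  characterises the conditional expectation.\<close>

lemma nn_cond_exp_regular_cond_dist:
  assumes P: "prob_space P" and \<kappa>: "regular_cond_dist P Y N \<kappa>"
    and F: "F \<in> borel_measurable P"
  shows "AE z in P. (\<integral>\<^sup>+z'. F z' \<partial>\<kappa> (Y z)) = nn_cond_exp P (vimage_algebra (space P) Y N) F z"
proof -
  define \<Y> where "\<Y> = vimage_algebra (space P) Y N"
  note D = regular_cond_distD[OF \<kappa>]
  interpret prob_space P by fact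
  interpret finite_measure_subalgebra P \<Y>
    unfolding \<Y>_def by (rule finite_measure_subalgebra_vimage[OF P D(1)])
  have meas: "(\<lambda>z. \<integral>\<^sup>+z'. F z' \<partial>\<kappa> (Y z)) \<in> borel_measurable \<Y>"
    unfolding \<Y>_def
    by (rule measurable_comp_vimage_algebra[OF D(1), where h="\<lambda>y. \<integral>\<^sup>+z'. F z' \<partial>\<kappa> y"])
      (rule measurable_compose[OF D(3) nn_integral_measurable_subprob_algebra[OF F]])
  have \<kappa>Y [measurable]: "(\<lambda>z. \<kappa> (Y z)) \<in> P \<rightarrow>\<^sub>M subprob_algebra P"
    by (rule measurable_compose[OF D(1) D(3)])
  have main: "(\<integral>\<^sup>+z\<in>B. F z \<partial>P) = (\<integral>\<^sup>+z\<in>B. (\<integral>\<^sup>+z'. F z' \<partial>\<kappa> (Y z)) \<partial>P)"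
    if B: "B \<in> sets \<Y>" for B
  proof -
    have BP [measurable]: "B \<in> sets P" using B subalg by (auto simp: subalgebra_def)
    define PB where "PB = density P (indicator B)"
    have \<kappa>PB: "(\<lambda>z. \<kappa> (Y z)) \<in> PB \<rightarrow>\<^sub>M subprob_algebra P"
      unfolding PB_def by simp
    have ne: "space PB \<noteq> {}" unfolding PB_def by (simp add: not_empty)
    have "PB = PB \<bind> (\<lambda>z. \<kappa> (Y z))"
    proof (rule measure_eqI)
      show s: "sets PB = sets (PB \<bind> (\<lambda>z. \<kappa> (Y z)))"
        using sets_bind[OF _ ne, of "\<lambda>z. \<kappa> (Y z)" P] D(5) by (simp add: PB_def)
      fix A assume "A \<in> sets PB"
      then have A [measurable]: "A \<in> sets P" by (simp add: PB_def)
      have m: "(\<lambda>z. measure (\<kappa> (Y z)) A) \<in> borel_measurable P"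
        using measurable_compose[OF D(1) measurable_compose[OF D(2) measurable_measure_prob_algebra[OF A]]]
        by simp
      have "emeasure (PB \<bind> (\<lambda>z. \<kappa> (Y z))) A = (\<integral>\<^sup>+z. emeasure (\<kappa> (Y z)) A \<partial>PB)"
        by (rule emeasure_bind[OF ne \<kappa>PB A])
      also have "\<dots> = (\<integral>\<^sup>+z. indicator B z * emeasure (\<kappa> (Y z)) A \<partial>P)"
        unfolding PB_def by (intro nn_integral_density) measurable
      also have "\<dots> = (\<integral>\<^sup>+z. ennreal (indicator B z * measure (\<kappa> (Y z)) A) \<partial>P)"
        using D(6) by (intro nn_integral_cong)
          (auto simp: prob_space.finite_measure finite_measure.emeasure_eq_measure split: split_indicator)
      also have "\<dots> = ennreal (\<integral>z. indicator B z * measure (\<kappa> (Y z)) A \<partial>P)"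
        using m D(6) by (intro nn_integral_eq_integral integrable_const_bound[where B=1])
          (auto simp: prob_space.prob_le_1 split: split_indicator)
      also have "(\<integral>z. indicator B z * measure (\<kappa> (Y z)) A \<partial>P)
        = (\<integral>z\<in>B. real_cond_exp P \<Y> (indicator A) z \<partial>P)"
        unfolding set_lebesgue_integral_def using D(4)[OF A] m
        by (intro integral_cong_AE) (auto simp: \<Y>_def)
      also have "\<dots> = (\<integral>z\<in>B. indicator A z \<partial>P)"
        using A B by (intro real_cond_exp_intA[symmetric]) (auto simp: emeasure_eq_measure)
      also have "\<dots> = measure P (A \<inter> B)"
        unfolding set_lebesgue_integral_def
        by (simp add: indicator_inter_arith[symmetric] Int_commute)
      also have "ennreal (measure P (A \<inter> B)) = emeasure PB A"
        unfolding PB_def by (simp add: emeasure_density indicator_inter_arith[symmetric] emeasure_eq_measure Int_commute)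
      finally show "emeasure PB A = emeasure (PB \<bind> (\<lambda>z. \<kappa> (Y z))) A" ..
    qed
    then have "(\<integral>\<^sup>+z. F z \<partial>PB) = (\<integral>\<^sup>+z. (\<integral>\<^sup>+z'. F z' \<partial>\<kappa> (Y z)) \<partial>PB)"
      using nn_integral_bind[OF F \<kappa>PB] by simp
    then show ?thesis
      unfolding PB_def using F measurable_from_subalg[OF subalg meas]
      by (simp add: nn_integral_density mult.commute)
  qed
  show ?thesis
    unfolding \<Y>_def[symmetric] by (rule nn_cond_exp_charact[OF main F meas])
qed

text \<open>Almost everywhere finiteness of the conditional expectation of
  \<open>\<bar>F z\<bar>\<close> makes \<open>F\<close> integrable under almost every
  \<open>\<kappa> (Y z)\<close>. The Bochner integral then splits into positive and negative part,
  which is how \<open>real_cond_exp\<close> is built.\<close>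

lemma cond_mean_eq_real_cond_exp:
  assumes P: "prob_space P" and \<kappa>: "regular_cond_dist P Y N \<kappa>"
    and F: "integrable P F"
  shows "AE z in P. cond_mean \<kappa> F (Y z) = real_cond_exp P (vimage_algebra (space P) Y N) F z"
proof -
  define \<Y> where "\<Y> = vimage_algebra (space P) Y N"
  note D = regular_cond_distD[OF \<kappa>]
  interpret prob_space P by fact
  interpret finite_measure_subalgebra P \<Y>
    unfolding \<Y>_def by (rule finite_measure_subalgebra_vimage[OF P D(1)])
  have Fm [measurable]: "F \<in> borel_measurable P" using F by auto
  note N = nn_cond_exp_regular_cond_dist[OF P \<kappa>, folded \<Y>_def]
  have "(\<integral>\<^sup>+z. nn_cond_exp P \<Y> (\<lambda>z. ennreal \<bar>F z\<bar>) z \<partial>P) = (\<integral>\<^sup>+z. ennreal \<bar>F z\<bar> \<partial>P)"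
    using nn_cond_exp_intg[of "\<lambda>_. 1" "\<lambda>z. ennreal \<bar>F z\<bar>"] by simp
  also have "\<dots> \<noteq> \<infinity>" using F unfolding integrable_iff_bounded by auto
  finally have "AE z in P. nn_cond_exp P \<Y> (\<lambda>z. ennreal \<bar>F z\<bar>) z \<noteq> \<infinity>"
    by (intro nn_integral_PInf_AE) auto
  moreover have "AE z in P. (\<integral>\<^sup>+z'. ennreal \<bar>F z'\<bar> \<partial>\<kappa> (Y z)) = nn_cond_exp P \<Y> (\<lambda>z. ennreal \<bar>F z\<bar>) z"
    by (rule N) measurable
  moreover have "AE z in P. (\<integral>\<^sup>+z'. ennreal (F z') \<partial>\<kappa> (Y z)) = nn_cond_exp P \<Y> (\<lambda>z. ennreal (F z)) z"
    by (rule N) measurable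
  moreover have "AE z in P. (\<integral>\<^sup>+z'. ennreal (- F z') \<partial>\<kappa> (Y z)) = nn_cond_exp P \<Y> (\<lambda>z. ennreal (- F z)) z"
    by (rule N) measurable
  moreover note AE_space[of P]
  ultimately show ?thesis unfolding \<Y>_def[symmetric]
  proof (eventually_elim, goal_cases)
    case (1 z)
    have "F \<in> borel_measurable (\<kappa> (Y z))"
      using 1 Fm measurable_cong_sets[OF D(5) refl] by blast
    then have "integrable (\<kappa> (Y z)) F"
      using 1 by (intro integrableI_bounded) (auto simp: less_top)
    then show ?case
      using 1 by (simp add: cond_mean_def real_lebesgue_integral_def real_cond_exp_def)
  qed
qed

lemma borel_measurable_cond_mean:
  assumes "regular_cond_dist P Y N \<kappa>" "F \<in> borel_measurable P"
  shows "(\<lambda>z. cond_mean \<kappa> F (Y z)) \<in> borel_measurable P"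
  unfolding cond_mean_def
  using regular_cond_distD(1,3)[OF assms(1)] integral_measurable_subprob_algebra[OF assms(2)]
  by (auto intro!: measurable_compose[of Y P N] measurable_compose[of \<kappa>])

text \<open>It suffices to test the rational half-lines \<open>{h \<le> q}\<close>, because their indicators are
  functions of \<open>Y\<close>.\<close>

lemma regular_cond_dist_concentrated:
  fixes h :: "'y \<Rightarrow> real"
  assumes P: "prob_space P" and \<kappa>: "regular_cond_dist P Y N \<kappa>" and h: "h \<in> borel_measurable N"
  shows "AE z in P. AE z' in \<kappa> (Y z). h (Y z') = h (Y z)"
proof -
  define \<Y> where "\<Y> = vimage_algebra (space P) Y N"
  note D = regular_cond_distD[OF \<kappa>]
  interpret prob_space P by fact
  interpret finite_measure_subalgebra P \<Y>
    unfolding \<Y>_def by (rule finite_measure_subalgebra_vimage[OF P D(1)])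
  have hY [measurable]: "(\<lambda>z. h (Y z)) \<in> borel_measurable \<Y>"
    unfolding \<Y>_def by (rule measurable_comp_vimage_algebra[OF D(1) h])
  have sp: "space \<Y> = space P" unfolding \<Y>_def by simp
  define A where "A q = {z\<in>space P. h (Y z) \<le> of_rat q}" for q :: rat
  have AY [measurable]: "A q \<in> sets \<Y>" for q
    unfolding A_def sp[symmetric] by measurable
  then have AP: "A q \<in> sets P" for q using subalg by (auto simp: subalgebra_def)
  have "AE z in P. measure (\<kappa> (Y z)) (A q) = indicator (A q) z" for q
  proof -
    have "AE z in P. real_cond_exp P \<Y> (indicator (A q)) z = indicator (A q) z"
      using AP by (intro real_cond_exp_F_meas) (auto simp: emeasure_eq_measure)
    with D(4)[OF AP[of q]] show ?thesis unfolding \<Y>_def[symmetric] by eventually_elim simp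
  qed
  then have "AE z in P. \<forall>q. measure (\<kappa> (Y z)) (A q) = indicator (A q) z"
    by (simp add: AE_all_countable)
  then show ?thesis using AE_space
  proof (eventually_elim, goal_cases)
    case (1 z)
    interpret K: prob_space "\<kappa> (Y z)" by (rule D(6)) fact
    have sK: "sets (\<kappa> (Y z)) = sets P" by (rule D(5)) fact
    have "AE z' in \<kappa> (Y z). z' \<in> A q \<longleftrightarrow> z \<in> A q" for q
    proof (cases "z \<in> A q")
      case True
      then have "AE z' in \<kappa> (Y z). z' \<in> A q"
        using 1(1) AP sK by (intro K.AE_prob_1) simp
      then show ?thesis by eventually_elim (simp add: True)
    next
      case False
      then have "AE z' in \<kappa> (Y z). z' \<notin> A q"
        using 1 AP sK by (intro AE_not_in) (auto simp: null_sets_def K.emeasure_eq_measure)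
      then show ?thesis by eventually_elim (simp add: False)
    qed
    then have "AE z' in \<kappa> (Y z). \<forall>q. z' \<in> A q \<longleftrightarrow> z \<in> A q" by (simp add: AE_all_countable)
    then show ?case using AE_space
    proof eventually_elim
      case (elim z')
      have "z' \<in> space P" using elim sets_eq_imp_space_eq[OF sK] by simp
      then have *: "h (Y z') \<le> of_rat q \<longleftrightarrow> h (Y z) \<le> of_rat q" for q
        using elim 1 by (auto simp: A_def)
      show "h (Y z') = h (Y z)"
      proof (rule ccontr)
        assume "h (Y z') \<noteq> h (Y z)"
        then consider "h (Y z') < h (Y z)" | "h (Y z) < h (Y z')" by linarith
        then show False using * of_rat_dense by cases (meson less_imp_le not_less)+
      qed
    qed
  qed
qed

subsection \<open>Bounds on increments from bounds on derivatives\<close>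

text \<open>A Caratheodory argument: rounding \<open>t\<close> down to the grid of mesh
  \<open>1 / (n + 1)\<close> leaves countably many values of the first argument, where joint
  measurability is clear, and continuity in \<open>t\<close> recovers \<open>u\<close> in the
  limit.\<close>

lemma borel_measurable_continuous_fst:
  fixes u :: "real \<Rightarrow> 'a \<Rightarrow> real"
  assumes m: "\<And>t. u t \<in> borel_measurable M"
    and c: "\<And>z. z \<in> space M \<Longrightarrow> continuous_on UNIV (\<lambda>t. u t z)"
  shows "(\<lambda>(t, z). u t z) \<in> borel_measurable (borel \<Otimes>\<^sub>M M)"
proof (rule borel_measurable_LIMSEQ_real)
  define s where "s n t = of_int \<lfloor>real (Suc n) * t\<rfloor> / real (Suc n)" for n t
  show "(\<lambda>n. u (s n (fst p)) (snd p)) \<longlonglongrightarrow> (case p of (t, z) \<Rightarrow> u t z)"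
    if "p \<in> space (borel \<Otimes>\<^sub>M M)" for p
  proof -
    have z: "snd p \<in> space M" using that by (auto simp: space_pair_measure)
    have "(\<lambda>n. s n (fst p)) \<longlonglongrightarrow> fst p"
    proof (rule tendsto_sandwich)
      show "\<forall>\<^sub>F n in sequentially. fst p - 1 / real (Suc n) \<le> s n (fst p)"
      proof (intro always_eventually allI)
        fix n
        have "fst p - 1 / real (Suc n) = (real (Suc n) * fst p - 1) / real (Suc n)"
          by (simp add: diff_divide_distrib)
        also have "\<dots> \<le> s n (fst p)"
          unfolding s_def by (intro divide_right_mono) linarith+
        finally show "fst p - 1 / real (Suc n) \<le> s n (fst p)" .
      qed
      show "\<forall>\<^sub>F n in sequentially. s n (fst p) \<le> fst p"
      proof (intro always_eventually allI)
        fix n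
        have "s n (fst p) \<le> (real (Suc n) * fst p) / real (Suc n)"
          unfolding s_def by (intro divide_right_mono) linarith+
        then show "s n (fst p) \<le> fst p" by simp
      qed
      show "(\<lambda>n. fst p - 1 / real (Suc n)) \<longlonglongrightarrow> fst p"
        using tendsto_diff[OF tendsto_const LIMSEQ_inverse_real_of_nat, of "fst p"]
        by (simp add: divide_inverse)
    qed simp
    then have "(\<lambda>n. u (s n (fst p)) (snd p)) \<longlonglongrightarrow> u (fst p) (snd p)"
      using continuous_on_tendsto_compose[OF c[OF z]] by auto
    then show ?thesis by (simp add: case_prod_beta)
  qed
  show "(\<lambda>p. u (s n (fst p)) (snd p)) \<in> borel_measurable (borel \<Otimes>\<^sub>M M)" for n
    unfolding s_def
    by (rule measurable_compose_countable[where
        f="\<lambda>i p. u (of_int i / real (Suc n)) (snd p)" and g="\<lambda>p. \<lfloor>real (Suc n) * fst p\<rfloor>"])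
      (use m in measurable)
qed

text \<open>The limit runs along one fixed sequence of increments, so joint measurability in
  \<open>(t, z)\<close> passes from the difference quotients to it.\<close>

definition right_deriv :: "(real \<Rightarrow> 'a \<Rightarrow> real) \<Rightarrow> real \<Rightarrow> 'a \<Rightarrow> real" where
  "right_deriv u t z = lim (\<lambda>n. (u (t + 1 / real (Suc n)) z - u t z) * real (Suc n))"

lemma borel_measurable_right_deriv:
  assumes [measurable]: "(\<lambda>(t, z). u t z) \<in> borel_measurable (borel \<Otimes>\<^sub>M M)"
  shows "(\<lambda>(t, z). right_deriv u t z) \<in> borel_measurable (borel \<Otimes>\<^sub>M M)"
  unfolding right_deriv_def by measurable

text \<open>Increments to the right suffice for a derivative within an interval, including at its
  left end. Strictness of \<open>t < b\<close> puts the points \<open>t + 1 / (n + 1)\<close>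
  eventually inside.\<close>

lemma has_real_derivative_right_LIMSEQ:
  assumes D: "(f has_real_derivative d) (at t within {a..b})" and t: "a \<le> t" "t < b"
  shows "(\<lambda>n. (f (t + 1 / real (Suc n)) - f t) * real (Suc n)) \<longlonglongrightarrow> d"
proof -
  have l: "((\<lambda>y. (f y - f t) / (y - t)) \<longlongrightarrow> d) (at t within {a..b})"
    using D by (simp add: has_field_derivative_iff)
  have 0: "(\<lambda>n. t + 1 / real (Suc n)) \<longlonglongrightarrow> t"
    using tendsto_add[OF tendsto_const LIMSEQ_inverse_real_of_nat, of t] by (simp add: divide_inverse)
  have "filterlim (\<lambda>n. t + 1 / real (Suc n)) (at t within {a..b}) sequentially"
    unfolding filterlim_at
  proof
    have "\<forall>\<^sub>F n in sequentially. t + 1 / real (Suc n) < b" using order_tendstoD(2)[OF 0 t(2)] .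
    then show "\<forall>\<^sub>F n in sequentially. t + 1 / real (Suc n) \<in> {a..b} \<and> t + 1 / real (Suc n) \<noteq> t"
      by (rule eventually_mono) (use t(1) in \<open>auto intro: add_increasing2\<close>)
  qed fact
  from filterlim_compose[OF l this] show ?thesis by simp
qed

lemma right_deriv_eq:
  assumes "((\<lambda>s. u s z) has_real_derivative d) (at t within {a..b})" "a \<le> t" "t < b"
  shows "right_deriv u t z = d"
  unfolding right_deriv_def by (rule limI[OF has_real_derivative_right_LIMSEQ[OF assms]])

text \<open>The derivative need not be continuous in \<open>v\<close>, so the exceptional null sets cannot be
  collected over the rationals.  Fubini gives the bound for almost every \<open>v\<close>, which suffices
  for the Henstock--Kurzweil form of the fundamental theorem of calculus.\<close>

lemma AE_increment_ge:
  fixes S D :: "real \<Rightarrow> 'a \<Rightarrow> real"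
  assumes M: "sigma_finite_measure M"
    and S: "\<And>v. S v \<in> borel_measurable M"
    and D: "AE z in M. \<forall>v. ((\<lambda>v. S v z) has_real_derivative D v z) (at v)"
    and ge: "\<And>v. AE z in M. \<alpha> \<le> D v z"
  shows "AE z in M. \<forall>a b. a \<le> b \<longrightarrow> \<alpha> * (b - a) \<le> S b z - S a z"
proof -
  interpret sigma_finite_measure M by fact
  interpret pair_sigma_finite M lborel ..
  from D obtain N where N: "N \<in> null_sets M"
    "{z\<in>space M. \<not> (\<forall>v. ((\<lambda>v. S v z) has_real_derivative D v z) (at v))} \<subseteq> N"
    by (auto elim!: AE_E simp: null_sets_def)
  \<comment> \<open>The value 0 on the exceptional set makes \<open>S'\<close> continuous in
    \<open>v\<close> for every \<open>z\<close>, as the joint measurability lemma requires.\<close>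
  define S' where "S' v z = (if z \<in> N then 0 else S v z)" for v z
  have [measurable]: "N \<in> sets M" using N by auto
  have deriv: "((\<lambda>v. S v z) has_real_derivative D v z) (at v)" if "z \<in> space M - N" for z v
    using that N by auto
  have S'_meas: "(\<lambda>(v, z). S' v z) \<in> borel_measurable (borel \<Otimes>\<^sub>M M)"
  proof (rule borel_measurable_continuous_fst)
    show "S' v \<in> borel_measurable M" for v
      unfolding S'_def[abs_def] using S[of v] by measurable
    show "continuous_on UNIV (\<lambda>v. S' v z)" if "z \<in> space M" for z
    proof (cases "z \<in> N")
      case False
      then show ?thesis unfolding S'_def using deriv[of z] that
        by (auto intro!: continuous_at_imp_continuous_on intro: DERIV_isCont)
    qed (simp add: S'_def)
  qed
  define D' where "D' = right_deriv S'"
  have D'_meas [measurable]: "(\<lambda>(v, z). D' v z) \<in> borel_measurable (borel \<Otimes>\<^sub>M M)"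
    unfolding D'_def by (rule borel_measurable_right_deriv[OF S'_meas])
  have D'_eq: "D' v z = D v z" if "z \<in> space M - N" for v z
    unfolding D'_def
    by (rule right_deriv_eq[where a=v and b="v+1"])
      (use deriv[OF that, of v] that in \<open>auto simp: S'_def intro: has_field_derivative_at_within\<close>)
  have good: "AE z in M. z \<in> space M - N"
    using AE_not_in[OF N(1)] AE_space by eventually_elim auto
  have "AE z in M. AE v in lborel. \<alpha> \<le> D' v z"
  proof -
    have "{p \<in> space (M \<Otimes>\<^sub>M lborel). \<alpha> \<le> D' (snd p) (fst p)} \<in> sets (M \<Otimes>\<^sub>M lborel)"
      by measurable
    moreover have "AE z in M. \<alpha> \<le> D' v z" for v
      using ge[of v] good by eventually_elim (simp add: D'_eq)
    ultimately show ?thesis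
      using AE_commute[of "\<lambda>z v. \<alpha> \<le> D' v z"] by simp
  qed
  then show ?thesis using good
  proof (eventually_elim, intro allI impI)
    fix z and a b :: real
    assume *: "AE v in lborel. \<alpha> \<le> D' v z" "z \<in> space M - N" "a \<le> b"
    obtain N' where N': "N' \<in> null_sets lborel" "{v. \<not> \<alpha> \<le> D v z} \<subseteq> N'"
      using *(1) unfolding D'_eq[OF *(2)] by (auto elim!: AE_E simp: null_sets_def)
    have "negligible N'"
      using N'(1) null_sets_completionI by (auto simp: negligible_iff_null_sets)
    have "((\<lambda>v. D v z) has_integral S b z - S a z) {a..b}"
      using deriv[OF *(2)] *(3)
      by (intro fundamental_theorem_of_calculus)
        (auto simp flip: has_real_derivative_iff_has_vector_derivative intro: has_field_derivative_at_within)
    \<comment> \<open>Comparing integrals needs the bound at every point. Raising the derivative to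
      \<open>\<alpha>\<close> where it falls below alters it only on the negligible set
      \<open>N'\<close>.\<close>
    then have max: "((\<lambda>v. max \<alpha> (D v z)) has_integral S b z - S a z) {a..b}"
      by (rule has_integral_spike[OF \<open>negligible N'\<close>, rotated]) (use N'(2) in \<open>auto simp: max_def\<close>)
    have "((\<lambda>v. \<alpha>) has_integral \<alpha> * (b - a)) {a..b}"
      using has_integral_const_real[of \<alpha> a b] *(3) by (simp add: mult.commute)
    then show "\<alpha> * (b - a) \<le> S b z - S a z"
      by (rule has_integral_le[OF _ max]) simp
  qed
qed

subsection \<open>Square integrability and second-order remainders\<close>

text \<open>The later estimates are made on integrals of squares in \<open>ennreal\<close>, where no
  finiteness has to be known beforehand; this is the passage between them and norms.\<close>

lemma L2_norm_le_iff:
  assumes "0 \<le> e"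
  shows "L2_norm M f \<le> ennreal e \<longleftrightarrow> (\<integral>\<^sup>+x. ennreal ((f x)\<^sup>2) \<partial>M) \<le> ennreal (e\<^sup>2)"
proof (cases "\<integral>\<^sup>+x. ennreal ((f x)\<^sup>2) \<partial>M" rule: ennreal_cases)
  case (real r)
  then show ?thesis using assms real_sqrt_le_iff[of r "e\<^sup>2"]
    by (auto simp: L2_norm_def)
qed (auto simp: L2_norm_def top_unique)

lemma L2_norm_cong_AE:
  assumes "AE x in M. f x = g x"
  shows "L2_norm M f = L2_norm M g"
proof -
  have "(\<integral>\<^sup>+x. ennreal ((f x)\<^sup>2) \<partial>M) = (\<integral>\<^sup>+x. ennreal ((g x)\<^sup>2) \<partial>M)"
    using assms by (intro nn_integral_cong_AE) auto
  then show ?thesis by (simp add: L2_norm_def)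
qed

lemma integrable_square_of_nn_integral:
  fixes f :: "'a \<Rightarrow> real"
  assumes [measurable]: "f \<in> borel_measurable M" and "(\<integral>\<^sup>+x. ennreal ((f x)\<^sup>2) \<partial>M) \<le> ennreal C"
  shows "integrable M (\<lambda>x. (f x)\<^sup>2)"
  using assms(2) by (intro integrableI_nonneg) (auto simp: less_top[symmetric] top_unique)

text \<open>The cross term of the expanded square is bounded by Cauchy-Schwarz. Real numbers
  \<open>a\<close> and \<open>b\<close> bounding the norms stand in for the norms, which avoids
  square roots in \<open>ennreal\<close>.\<close>

lemma Minkowski_nn_integral_square:
  fixes f g :: "'a \<Rightarrow> real"
  assumes [measurable]: "f \<in> borel_measurable M" "g \<in> borel_measurable M"
    and a: "0 \<le> a" "(\<integral>\<^sup>+x. ennreal ((f x)\<^sup>2) \<partial>M) \<le> ennreal (a\<^sup>2)"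
    and b: "0 \<le> b" "(\<integral>\<^sup>+x. ennreal ((g x)\<^sup>2) \<partial>M) \<le> ennreal (b\<^sup>2)"
  shows "(\<integral>\<^sup>+x. ennreal ((\<bar>f x\<bar> + \<bar>g x\<bar>)\<^sup>2) \<partial>M) \<le> ennreal ((a + b)\<^sup>2)"
proof -
  define c where "c = (\<integral>\<^sup>+x. ennreal \<bar>f x\<bar> * ennreal \<bar>g x\<bar> \<partial>M)"
  have "c\<^sup>2 \<le> (\<integral>\<^sup>+x. (ennreal \<bar>f x\<bar>)\<^sup>2 \<partial>M) * (\<integral>\<^sup>+x. (ennreal \<bar>g x\<bar>)\<^sup>2 \<partial>M)"
    unfolding c_def by (rule Cauchy_Schwarz_nn_integral) measurable
  also have "\<dots> \<le> ennreal (a\<^sup>2) * ennreal (b\<^sup>2)"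
    using a b by (intro mult_mono) (auto simp: ennreal_power)
  also have "\<dots> = (ennreal (a * b))\<^sup>2"
    using a b by (simp add: ennreal_mult ennreal_power power_mult_distrib)
  finally have c: "c \<le> ennreal (a * b)"
    by (cases c rule: ennreal_cases)
      (use a b in \<open>auto simp: ennreal_power top_unique intro!: ennreal_leI power2_le_imp_le\<close>)
  have "(\<integral>\<^sup>+x. ennreal ((\<bar>f x\<bar> + \<bar>g x\<bar>)\<^sup>2) \<partial>M)
    = (\<integral>\<^sup>+x. ennreal ((f x)\<^sup>2) + (2 * (ennreal \<bar>f x\<bar> * ennreal \<bar>g x\<bar>) + ennreal ((g x)\<^sup>2)) \<partial>M)"
    by (intro nn_integral_cong)
      (simp add: power2_sum algebra_simps flip: ennreal_plus ennreal_mult ennreal_numeral)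
  also have "\<dots> = (\<integral>\<^sup>+x. ennreal ((f x)\<^sup>2) \<partial>M) + (2 * c + (\<integral>\<^sup>+x. ennreal ((g x)\<^sup>2) \<partial>M))"
    unfolding c_def by (simp add: nn_integral_add nn_integral_cmult)
  also have "\<dots> \<le> ennreal (a\<^sup>2) + (2 * ennreal (a * b) + ennreal (b\<^sup>2))"
    using a b c by (intro add_mono mult_mono) auto
  also have "\<dots> = ennreal ((a + b)\<^sup>2)"
    using a b by (simp add: power2_sum algebra_simps flip: ennreal_plus ennreal_mult ennreal_numeral)
  finally show ?thesis .
qed

text \<open>Conditional Jensen for the square, integrated: conditioning is a contraction of the
  space of square integrable functions.\<close>

lemma (in finite_measure_subalgebra) nn_integral_real_cond_exp_square_le:
  fixes f :: "'a \<Rightarrow> real"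
  assumes f: "integrable M f" and e: "(\<integral>\<^sup>+x. ennreal ((f x)\<^sup>2) \<partial>M) \<le> ennreal C"
  shows "(\<integral>\<^sup>+x. ennreal ((real_cond_exp M F f x)\<^sup>2) \<partial>M) \<le> ennreal C"
proof -
  have f2: "integrable M (\<lambda>x. (f x)\<^sup>2)"
    using integrable_square_of_nn_integral[OF borel_measurable_integrable[OF f] e] .
  have "AE x in M. (real_cond_exp M F f x)\<^sup>2 \<le> real_cond_exp M F (\<lambda>x. (f x)\<^sup>2) x"
    by (rule real_cond_exp_jensens_inequality(2)[OF f, where I=UNIV and q="\<lambda>x. x\<^sup>2"])
      (use f2 in \<open>auto intro: convex_power2\<close>)
  then have "(\<integral>\<^sup>+x. ennreal ((real_cond_exp M F f x)\<^sup>2) \<partial>M)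
    \<le> (\<integral>\<^sup>+x. ennreal (real_cond_exp M F (\<lambda>x. (f x)\<^sup>2) x) \<partial>M)"
    by (intro nn_integral_mono_AE) (auto intro: ennreal_leI)
  also have "\<dots> = ennreal (\<integral>x. real_cond_exp M F (\<lambda>x. (f x)\<^sup>2) x \<partial>M)"
    using f2 by (intro nn_integral_eq_integral real_cond_exp_int real_cond_exp_pos) auto
  also have "\<dots> = (\<integral>\<^sup>+x. ennreal ((f x)\<^sup>2) \<partial>M)"
    using f2 by (simp add: real_cond_exp_int nn_integral_eq_integral)
  finally show ?thesis using e by simp
qed

lemma nn_integral_Taylor2_weight:
  assumes "0 \<le> t"
  shows "(\<integral>\<^sup>+s. ennreal (indicator {0..t} s * (t - s)) \<partial>lborel) = ennreal (t\<^sup>2 / 2)"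
proof -
  have "(\<integral>\<^sup>+s. ennreal (indicator {0..t} s * (t - s)) \<partial>lborel)
    = (\<integral>\<^sup>+s. ennreal (t - s) * indicator {0..t} s \<partial>lborel)"
    by (intro nn_integral_cong) (auto split: split_indicator)
  also have "\<dots> = ennreal ((\<lambda>s. t * s - s\<^sup>2 / 2) t - (\<lambda>s. t * s - s\<^sup>2 / 2) 0)"
    by (rule nn_integral_FTC_Icc) (use assms in \<open>auto intro!: derivative_eq_intros\<close>)
  also have "\<dots> = ennreal (t\<^sup>2 / 2)" by (simp add: power2_eq_square field_simps)
  finally show ?thesis .
qed

text \<open>Taylor's formula with integral remainder, followed by Cauchy-Schwarz for the weight
  \<open>t - s\<close> on \<open>{0..t}\<close>, whose mass is \<open>t^2 / 2\<close>. The integral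
  of \<open>f2\<close> is at first a gauge integral; the Borel function \<open>g\<close>, equal to
  \<open>f2\<close> before \<open>t\<close>, leads to a Lebesgue integral.\<close>

lemma Taylor2_square_le:
  fixes f f1 f2 :: "real \<Rightarrow> real"
  assumes t: "0 \<le> t"
    and f1: "\<And>s. s \<in> {0..t} \<Longrightarrow> (f has_real_derivative f1 s) (at s within {0..t})"
    and f2: "\<And>s. s \<in> {0..t} \<Longrightarrow> (f1 has_real_derivative f2 s) (at s within {0..t})"
    and g: "g \<in> borel_measurable borel" "\<And>s. s \<in> {0..<t} \<Longrightarrow> g s = f2 s"
  shows "ennreal ((f t - f 0 - t * f1 0)\<^sup>2)
    \<le> ennreal (t\<^sup>2 / 2) * (\<integral>\<^sup>+s. ennreal (indicator {0..t} s * (t - s)) * ennreal ((g s)\<^sup>2) \<partial>lborel)"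
proof -
  define w where "w s = indicator {0..t} s * (t - s)" for s :: real
  have [measurable]: "g \<in> borel_measurable borel" "w \<in> borel_measurable borel"
    using g unfolding w_def by auto
  have w0: "0 \<le> w s" for s unfolding w_def by (auto split: split_indicator)
  define Df where "Df i = (if i = 0 then f else if i = 1 then f1 else f2)" for i :: nat
  have "((\<lambda>s. ((t - s) ^ (2 - 1) / fact (2 - 1)) *\<^sub>R Df 2 s)
     has_integral f t - (\<Sum>i<2. ((t - 0) ^ i / fact i) *\<^sub>R Df i 0)) {0..t}"
    using t f1 f2 by (intro Taylor_has_integral)
      (auto simp: Df_def less_Suc_eq numeral_2_eq_2 has_real_derivative_iff_has_vector_derivative[symmetric])
  then have "((\<lambda>s. (t - s) * f2 s) has_integral f t - f 0 - t * f1 0) {0..t}"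
    by (simp add: Df_def numeral_2_eq_2 diff_diff_eq)
  then have "((\<lambda>s. (t - s) * g s) has_integral f t - f 0 - t * f1 0) {0..t}"
    by (rule has_integral_spike[of "{t}", rotated 2]) (use g(2) in auto)
  then have R: "((\<lambda>s. w s * g s) has_integral f t - f 0 - t * f1 0) UNIV"
    by (subst (asm) has_integral_restrict_UNIV[symmetric])
      (auto elim!: has_integral_eq[rotated] simp: w_def)
  define I where "I = (\<integral>\<^sup>+s. ennreal (w s * \<bar>g s\<bar>) \<partial>lborel)"
  have "ennreal \<bar>f t - f 0 - t * f1 0\<bar> \<le> I"
  \<comment> \<open>An infinite \<open>I\<close> leaves nothing to show. Otherwise the weighted
    \<open>g\<close> is Lebesgue integrable and its integral agrees with the gauge integral.\<close>
  proof (cases "I = \<infinity>")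
    case False
    then have int: "integrable lborel (\<lambda>s. w s * g s)"
      using w0 by (intro integrableI_bounded) (auto simp: I_def abs_mult less_top)
    have "f t - f 0 - t * f1 0 = (\<integral>s. w s * g s \<partial>lborel)"
      using has_integral_unique[OF R has_integral_integral_lborel[OF int]] .
    also have "ennreal \<bar>\<dots>\<bar> \<le> I"
      using integral_norm_bound_ennreal[OF int] w0 by (simp add: I_def abs_mult)
    finally show ?thesis .
  qed simp
  then have "ennreal ((f t - f 0 - t * f1 0)\<^sup>2) \<le> I\<^sup>2"
    using power_mono[of "ennreal \<bar>f t - f 0 - t * f1 0\<bar>" I 2] by (simp add: ennreal_power)
  \<comment> \<open>The weight is split into two square roots: one factor of Cauchy-Schwarz becomes
    the mass of \<open>w\<close>, the other keeps the weight next to the square of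
    \<open>g\<close>.\<close>
  also have "I = (\<integral>\<^sup>+s. ennreal (sqrt (w s)) * ennreal (sqrt (w s) * \<bar>g s\<bar>) \<partial>lborel)"
    unfolding I_def using w0
    by (intro nn_integral_cong) (simp add: mult.assoc[symmetric] flip: ennreal_mult)
  also have "\<dots>\<^sup>2 \<le> (\<integral>\<^sup>+s. (ennreal (sqrt (w s)))\<^sup>2 \<partial>lborel) * (\<integral>\<^sup>+s. (ennreal (sqrt (w s) * \<bar>g s\<bar>))\<^sup>2 \<partial>lborel)"
    by (rule Cauchy_Schwarz_nn_integral) measurable
  also have "(\<integral>\<^sup>+s. (ennreal (sqrt (w s)))\<^sup>2 \<partial>lborel) = ennreal (t\<^sup>2 / 2)"
  proof -
    have "(ennreal (sqrt (w s)))\<^sup>2 = ennreal (indicator {0..t} s * (t - s))" for s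
      using w0[of s] by (simp only: ennreal_power real_sqrt_ge_zero real_sqrt_pow2) (simp only: w_def)
    then show ?thesis using nn_integral_Taylor2_weight[OF t] by (simp only:)
  qed
  also have "(\<integral>\<^sup>+s. (ennreal (sqrt (w s) * \<bar>g s\<bar>))\<^sup>2 \<partial>lborel) = (\<integral>\<^sup>+s. ennreal (w s) * ennreal ((g s)\<^sup>2) \<partial>lborel)"
    using w0 by (intro nn_integral_cong) (simp add: ennreal_power power_mult_distrib ennreal_mult)
  finally show ?thesis unfolding w_def .
qed

text \<open>The pointwise Taylor estimate is integrated over \<open>z\<close> and the two integrals
  are interchanged. One factor \<open>t^2 / 2\<close> comes from Cauchy-Schwarz, the other from the
  mass of the weight. Measurability is given for \<open>u t\<close> alone, so \<open>D\<close> is a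
  measurable version of \<open>u1 0\<close> made from right derivatives.\<close>

lemma Taylor2_remainder_nn_integral_le:
  fixes u u1 u2 :: "real \<Rightarrow> 'a \<Rightarrow> real"
  assumes M: "sigma_finite_measure M"
    and u: "\<And>t. t \<in> {0..1} \<Longrightarrow> u t \<in> borel_measurable M"
    and d: "AE z in M. \<forall>t\<in>{0..1}. ((\<lambda>s. u s z) has_real_derivative u1 t z) (at t within {0..1}) \<and>
      ((\<lambda>s. u1 s z) has_real_derivative u2 t z) (at t within {0..1})"
    and C: "\<And>t. t \<in> {0..1} \<Longrightarrow> (\<integral>\<^sup>+z. ennreal ((u2 t z)\<^sup>2) \<partial>M) \<le> C"
  shows "\<exists>D\<in>borel_measurable M. \<forall>t\<in>{0..1}.
    (\<integral>\<^sup>+z. ennreal ((u t z - u 0 z - t * D z)\<^sup>2) \<partial>M) \<le> ennreal ((t\<^sup>2 / 2)\<^sup>2) * C"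
proof -
  interpret sigma_finite_measure M by fact
  interpret pair_sigma_finite M lborel ..
  define Q where "Q z \<longleftrightarrow> (\<forall>t\<in>{0..1}. ((\<lambda>s. u s z) has_real_derivative u1 t z) (at t within {0..1}) \<and>
      ((\<lambda>s. u1 s z) has_real_derivative u2 t z) (at t within {0..1}))" for z
  have "AE z in M. Q z" using d unfolding Q_def .
  then obtain N where N: "N \<in> null_sets M" and bad: "{z \<in> space M. \<not> Q z} \<subseteq> N"
    unfolding eventually_ae_filter by blast
  have du: "((\<lambda>s. u s z) has_real_derivative u1 t z) (at t within {0..1})"
    and du1: "((\<lambda>s. u1 s z) has_real_derivative u2 t z) (at t within {0..1})"
    if "z \<in> space M - N" "t \<in> {0..1}" for z t
    using that bad unfolding Q_def by blast+
  \<comment> \<open>Clamping \<open>t\<close> to \<open>{0..1}\<close> and annulling the exceptional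
    set yields a function on the whole line that is continuous in \<open>t\<close> for every
    \<open>z\<close> and measurable in \<open>z\<close> for every \<open>t\<close>.\<close>
  define w where "w t z = (if z \<in> N then 0 else u (max 0 (min 1 t)) z)" for t z
  have [measurable]: "N \<in> sets M" using N by (rule null_setsD2)
  have w_eq: "w t z = u t z" if "z \<notin> N" "t \<in> {0..1}" for t z
    using that by (simp add: w_def min_absorb2 max_absorb2)
  have w_meas [measurable]: "(\<lambda>(t, z). w t z) \<in> borel_measurable (borel \<Otimes>\<^sub>M M)"
  proof (rule borel_measurable_continuous_fst)
    show "w t \<in> borel_measurable M" for t
      unfolding w_def[abs_def] using u[of "max 0 (min 1 t)"] by measurable
    show "continuous_on UNIV (\<lambda>t. w t z)" if "z \<in> space M" for z
    proof (cases "z \<in> N")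
      case False
      have "continuous_on {0..1} (\<lambda>t. u t z)"
        unfolding continuous_on_eq_continuous_within
        using that False by (intro ballI DERIV_continuous[OF du]) auto
      moreover have "continuous_on UNIV (\<lambda>t::real. max 0 (min 1 t))"
        by (intro continuous_intros)
      ultimately have "continuous_on UNIV (\<lambda>t. u (max 0 (min 1 t)) z)"
        by (rule continuous_on_compose2) auto
      then show ?thesis using False by (simp add: w_def)
    qed (simp add: w_def)
  qed
  define w1 where "w1 = right_deriv w"
  define g where "g = right_deriv w1"
  have w1_meas [measurable]: "(\<lambda>(t, z). w1 t z) \<in> borel_measurable (borel \<Otimes>\<^sub>M M)"
    unfolding w1_def by (rule borel_measurable_right_deriv) measurable
  have g_meas [measurable]: "(\<lambda>(t, z). g t z) \<in> borel_measurable (borel \<Otimes>\<^sub>M M)"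
    unfolding g_def by (rule borel_measurable_right_deriv) measurable
  have w1_eq: "w1 t z = u1 t z" if "z \<in> space M - N" "t \<in> {0..<1}" for t z
    unfolding w1_def
  proof (rule right_deriv_eq[where a=0 and b=1])
    show "((\<lambda>s. w s z) has_real_derivative u1 t z) (at t within {0..1})"
      by (rule has_field_derivative_transform_within[of "\<lambda>s. u s z" _ _ _ 1])
        (use du[of z t] w_eq that in auto)
  qed (use that in auto)
  have g_eq: "g t z = u2 t z" if "z \<in> space M - N" "t \<in> {0..<1}" for t z
    unfolding g_def
  \<comment> \<open>Agreement of \<open>w1\<close> with \<open>u1\<close> is available only before
    time 1, since \<open>w\<close> is constant beyond it. The midpoint \<open>(t + 1) / 2\<close>
    keeps the interval in that range and still lies strictly to the right of
    \<open>t\<close>.\<close>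
  proof (rule right_deriv_eq[where a=0 and b="(t + 1) / 2"])
    have "((\<lambda>s. u1 s z) has_real_derivative u2 t z) (at t within {0..(t + 1) / 2})"
      using that by (intro DERIV_subset[OF du1]) auto
    then show "((\<lambda>s. w1 s z) has_real_derivative u2 t z) (at t within {0..(t + 1) / 2})"
      by (rule has_field_derivative_transform_within[of _ _ _ _ 1])
        (use that in \<open>auto intro!: w1_eq[symmetric]\<close>)
  qed (use that in auto)
  have good: "AE z in M. z \<in> space M - N"
    using AE_not_in[OF N] AE_space by eventually_elim auto
  have "(\<integral>\<^sup>+z. ennreal ((u t z - u 0 z - t * w1 0 z)\<^sup>2) \<partial>M) \<le> ennreal ((t\<^sup>2 / 2)\<^sup>2) * C"
    if t: "t \<in> {0..1}" for t
  proof -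
    define k where "k s = ennreal (indicator {0..t} s * (t - s))" for s :: real
    have [measurable]: "k \<in> borel_measurable borel" unfolding k_def by measurable
    have "AE z in M. ennreal ((u t z - u 0 z - t * w1 0 z)\<^sup>2)
      \<le> ennreal (t\<^sup>2 / 2) * (\<integral>\<^sup>+s. k s * ennreal ((g s z)\<^sup>2) \<partial>lborel)"
      using good
    proof eventually_elim
      case (elim z)
      have [measurable]: "z \<in> space M" using elim by auto
      show ?case unfolding k_def w1_eq[OF elim, of 0, simplified]
      proof (rule Taylor2_square_le[where g="\<lambda>s. g s z" and f="\<lambda>s. u s z" and ?f1.0="\<lambda>s. u1 s z" and ?f2.0="\<lambda>s. u2 s z"])
        show "(\<lambda>s. g s z) \<in> borel_measurable borel"
          using measurable_compose[OF _ g_meas, of "\<lambda>s. (s, z)" borel] by simp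
        show "((\<lambda>s. u s z) has_real_derivative u1 s z) (at s within {0..t})" if "s \<in> {0..t}" for s
          using that t by (intro DERIV_subset[OF du[OF elim]]) auto
        show "((\<lambda>s. u1 s z) has_real_derivative u2 s z) (at s within {0..t})" if "s \<in> {0..t}" for s
          using that t by (intro DERIV_subset[OF du1[OF elim]]) auto
      qed (use t g_eq[OF elim] in auto)
    qed
    then have "(\<integral>\<^sup>+z. ennreal ((u t z - u 0 z - t * w1 0 z)\<^sup>2) \<partial>M)
      \<le> (\<integral>\<^sup>+z. ennreal (t\<^sup>2 / 2) * (\<integral>\<^sup>+s. k s * ennreal ((g s z)\<^sup>2) \<partial>lborel) \<partial>M)"
      by (rule nn_integral_mono_AE)
    also have "\<dots> = ennreal (t\<^sup>2 / 2) * (\<integral>\<^sup>+z. (\<integral>\<^sup>+s. k s * ennreal ((g s z)\<^sup>2) \<partial>lborel) \<partial>M)"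
      by (intro nn_integral_cmult) measurable
    also have "(\<integral>\<^sup>+z. (\<integral>\<^sup>+s. k s * ennreal ((g s z)\<^sup>2) \<partial>lborel) \<partial>M)
      = (\<integral>\<^sup>+s. (\<integral>\<^sup>+z. k s * ennreal ((g s z)\<^sup>2) \<partial>M) \<partial>lborel)"
      by (rule Fubini'[symmetric]) measurable
    also have "\<dots> \<le> (\<integral>\<^sup>+s. k s * C \<partial>lborel)"
    proof (rule nn_integral_mono)
      fix s :: real
      show "(\<integral>\<^sup>+z. k s * ennreal ((g s z)\<^sup>2) \<partial>M) \<le> k s * C"
      \<comment> \<open>Outside this interval the weight vanishes, also at \<open>s = t\<close>;
        inside, \<open>s < 1\<close> holds and \<open>g\<close> is the second derivative.\<close>
      proof (cases "s \<in> {0..<t}")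
        case True
        have "(\<integral>\<^sup>+z. ennreal ((g s z)\<^sup>2) \<partial>M) = (\<integral>\<^sup>+z. ennreal ((u2 s z)\<^sup>2) \<partial>M)"
          using good True t by (intro nn_integral_cong_AE) (auto simp: g_eq)
        also have "\<dots> \<le> C" using True t by (intro C) auto
        finally show ?thesis
          by (subst nn_integral_cmult) (auto intro: mult_left_mono)
      next
        case False
        then have "k s = 0" by (auto simp: k_def split: split_indicator)
        then show ?thesis by simp
      qed
    qed
    also have "\<dots> = ennreal (t\<^sup>2 / 2) * C"
    proof -
      have "(\<integral>\<^sup>+s. k s \<partial>lborel) = ennreal (t\<^sup>2 / 2)"
        unfolding k_def using t by (intro nn_integral_Taylor2_weight) auto
      then show ?thesis by (subst nn_integral_multc) auto
    qed
    finally have "(\<integral>\<^sup>+z. ennreal ((u t z - u 0 z - t * w1 0 z)\<^sup>2) \<partial>M)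
      \<le> ennreal (t\<^sup>2 / 2) * ennreal (t\<^sup>2 / 2) * C"
      by (simp add: mult.assoc mult_left_mono)
    also have "ennreal (t\<^sup>2 / 2) * ennreal (t\<^sup>2 / 2) = ennreal ((t\<^sup>2 / 2)\<^sup>2)"
      unfolding power2_eq_square[of "t\<^sup>2 / 2"] by (rule ennreal_mult[symmetric]) auto
    finally show ?thesis .
  qed
  moreover have "w1 0 \<in> borel_measurable M"
    using measurable_compose[OF _ w1_meas, of "\<lambda>z. (0, z)" M] by simp
  ultimately show ?thesis by blast
qed

text \<open>The expansion at \<open>t = 1 / (n + 1)\<close> is conditioned and divided by
  \<open>t\<close>. The difference quotients of the conditioned \<open>u\<close> tend to 0, and the
  remainder over \<open>t\<close> has norm at most \<open>t * e / 2\<close>, so the conditional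
  expectation of \<open>D\<close> vanishes. At \<open>t = 1\<close> only the conditioned remainder
  is left.\<close>

lemma (in finite_measure_subalgebra) orthogonal_cond_exp_square_le:
  fixes u :: "real \<Rightarrow> 'a \<Rightarrow> real"
  assumes u: "\<And>t. t \<in> {0..1} \<Longrightarrow> integrable M (u t)"
    and D [measurable]: "D \<in> borel_measurable M"
    and e: "0 \<le> e"
    and R: "\<And>t. t \<in> {0..1} \<Longrightarrow>
      (\<integral>\<^sup>+z. ennreal ((u t z - u 0 z - t * D z)\<^sup>2) \<partial>M) \<le> ennreal ((t\<^sup>2 / 2 * e)\<^sup>2)"
    and lim: "AE z in M. (\<lambda>n. (real_cond_exp M F (u (1 / real (Suc n))) z - real_cond_exp M F (u 0) z)
      * real (Suc n)) \<longlonglongrightarrow> 0"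
    and zero: "AE z in M. real_cond_exp M F (u 0) z = 0"
  shows "(\<integral>\<^sup>+z. ennreal ((real_cond_exp M F (u 1) z)\<^sup>2) \<partial>M) \<le> ennreal ((e / 2)\<^sup>2)"
proof -
  define r where "r t z = u t z - u 0 z - t * D z" for t z
  have u0: "integrable M (u 0)" and u1: "integrable M (u 1)" by (auto intro!: u)
  have um [measurable]: "u 0 \<in> borel_measurable M" "u 1 \<in> borel_measurable M"
    using u0 u1 by (auto intro: borel_measurable_integrable)
  have r1m [measurable]: "r 1 \<in> borel_measurable M" unfolding r_def by measurable
  \<comment> \<open>Integrability of \<open>D\<close> is read off from the expansion at
    \<open>t = 1\<close>, where the remainder is square integrable.\<close>
  have "(\<integral>\<^sup>+z. ennreal ((r 1 z)\<^sup>2) \<partial>M) \<le> ennreal ((1\<^sup>2 / 2 * e)\<^sup>2)"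
    using R[of 1] unfolding r_def by simp
  then have "integrable M (\<lambda>z. (r 1 z)\<^sup>2)" by (rule integrable_square_of_nn_integral[OF r1m])
  then have "integrable M (r 1)" by (rule square_integrable_imp_integrable[OF r1m])
  then have "integrable M (\<lambda>z. u 1 z - u 0 z - r 1 z)" using u0 u1 by (intro Bochner_Integration.integrable_diff)
  then have Di: "integrable M D" by (simp add: r_def)
  define V where "V = real_cond_exp M F D"
  have ri: "integrable M (r t)" if "t \<in> {0..1}" for t
    unfolding r_def using u[OF that] u0 Di
    by (intro Bochner_Integration.integrable_diff integrable_mult_right)
  have rce: "AE z in M. real_cond_exp M F (r t) z
      = real_cond_exp M F (u t) z - real_cond_exp M F (u 0) z - t * V z" if "t \<in> {0..1}" for t
  proof -
    have "AE z in M. real_cond_exp M F (r t) z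
      = real_cond_exp M F (\<lambda>z. u t z - u 0 z) z - real_cond_exp M F (\<lambda>z. t * D z) z"
      unfolding r_def using u[OF that] u0 Di
      by (intro real_cond_exp_diff Bochner_Integration.integrable_diff integrable_mult_right)
    moreover have "AE z in M. real_cond_exp M F (\<lambda>z. u t z - u 0 z) z
      = real_cond_exp M F (u t) z - real_cond_exp M F (u 0) z"
      using u[OF that] u0 by (intro real_cond_exp_diff)
    moreover have "AE z in M. real_cond_exp M F (\<lambda>z. t * D z) z = t * V z"
      unfolding V_def using Di by (intro real_cond_exp_cmult)
    ultimately show ?thesis by eventually_elim simp
  qed
  \<comment> \<open>This is the conditioned remainder divided by its \<open>t\<close>. It tends to
    \<open>- V\<close> because the quotients of \<open>u\<close> tend to 0.\<close>
  define v where "v n z = real_cond_exp M F (r (1 / real (Suc n))) z * real (Suc n)" for n z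
  have v_meas [measurable]: "v n \<in> borel_measurable M" for n unfolding v_def by measurable
  have in01: "1 / real (Suc n) \<in> {0..1}" for n by simp
  have "AE z in M. \<forall>n. real_cond_exp M F (r (1 / real (Suc n))) z
      = real_cond_exp M F (u (1 / real (Suc n))) z - real_cond_exp M F (u 0) z - (1 / real (Suc n)) * V z"
    unfolding AE_all_countable using rce[OF in01] by blast
  then have "AE z in M. (\<lambda>n. v n z) \<longlonglongrightarrow> - V z"
    using lim
  proof eventually_elim
    case (elim z)
    have "v n z = (real_cond_exp M F (u (1 / real (Suc n))) z - real_cond_exp M F (u 0) z) * real (Suc n) - V z" for n
      unfolding v_def elim(1)[rule_format] by (simp add: field_simps)
    then show ?case using tendsto_diff[OF elim(2) tendsto_const[of "V z"]] by simp
  qed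
  then have "AE z in M. ennreal ((V z)\<^sup>2) = liminf (\<lambda>n. ennreal ((v n z)\<^sup>2))"
  proof eventually_elim
    case (elim z)
    have "(\<lambda>n. ennreal ((v n z)\<^sup>2)) \<longlonglongrightarrow> ennreal ((- V z)\<^sup>2)"
      using elim by (intro tendsto_ennrealI tendsto_power)
    from lim_imp_Liminf[OF _ this] show ?case by simp
  qed
  \<comment> \<open>Fatou's lemma: the norm of the pointwise limit is at most the lower limit of the
    norms, and these are at most \<open>e / (2 * (n + 1))\<close>.\<close>
  then have "(\<integral>\<^sup>+z. ennreal ((V z)\<^sup>2) \<partial>M) = (\<integral>\<^sup>+z. liminf (\<lambda>n. ennreal ((v n z)\<^sup>2)) \<partial>M)"
    by (rule nn_integral_cong_AE)
  also have "\<dots> \<le> liminf (\<lambda>n. \<integral>\<^sup>+z. ennreal ((v n z)\<^sup>2) \<partial>M)"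
    by (rule nn_integral_liminf) measurable
  also have "\<dots> \<le> liminf (\<lambda>n. ennreal ((e / 2 * (1 / real (Suc n)))\<^sup>2))"
  proof (intro Liminf_mono always_eventually allI)
    fix n
    have "(\<integral>\<^sup>+z. ennreal ((v n z)\<^sup>2) \<partial>M)
      = (\<integral>\<^sup>+z. ennreal ((real (Suc n))\<^sup>2) * ennreal ((real_cond_exp M F (r (1 / real (Suc n))) z)\<^sup>2) \<partial>M)"
      unfolding v_def by (intro nn_integral_cong) (simp add: power_mult_distrib mult.commute flip: ennreal_mult)
    also have "\<dots> = ennreal ((real (Suc n))\<^sup>2) * (\<integral>\<^sup>+z. ennreal ((real_cond_exp M F (r (1 / real (Suc n))) z)\<^sup>2) \<partial>M)"
      by (rule nn_integral_cmult) measurable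
    also have "\<dots> \<le> ennreal ((real (Suc n))\<^sup>2) * ennreal (((1 / real (Suc n))\<^sup>2 / 2 * e)\<^sup>2)"
      using R[OF in01[of n]] ri[OF in01[of n]]
      by (intro mult_left_mono nn_integral_real_cond_exp_square_le) (auto simp: r_def)
    also have "\<dots> = ennreal ((e / 2 * (1 / real (Suc n)))\<^sup>2)"
      by (simp add: power2_eq_square field_simps flip: ennreal_mult del: of_nat_Suc)
    finally show "(\<integral>\<^sup>+z. ennreal ((v n z)\<^sup>2) \<partial>M) \<le> ennreal ((e / 2 * (1 / real (Suc n)))\<^sup>2)" .
  qed
  also have "\<dots> = 0"
  proof -
    have "(\<lambda>n. ennreal ((e / 2 * (1 / real (Suc n)))\<^sup>2)) \<longlonglongrightarrow> ennreal ((e / 2 * 0)\<^sup>2)"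
      using LIMSEQ_inverse_real_of_nat
      by (intro tendsto_ennrealI tendsto_power tendsto_mult tendsto_const) (simp add: divide_inverse)
    from lim_imp_Liminf[OF _ this] show ?thesis by simp
  qed
  finally have "AE z in M. V z = 0"
    by (subst (asm) le_zero_eq, subst (asm) nn_integral_0_iff_AE) (auto simp: V_def)
  moreover have "AE z in M. real_cond_exp M F (r 1) z
      = real_cond_exp M F (u 1) z - real_cond_exp M F (u 0) z - 1 * V z"
    by (rule rce) simp
  moreover note zero
  ultimately have "AE z in M. real_cond_exp M F (u 1) z = real_cond_exp M F (r 1) z"
    by eventually_elim simp
  then have "(\<integral>\<^sup>+z. ennreal ((real_cond_exp M F (u 1) z)\<^sup>2) \<partial>M)
    = (\<integral>\<^sup>+z. ennreal ((real_cond_exp M F (r 1) z)\<^sup>2) \<partial>M)"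
    by (intro nn_integral_cong_AE) auto
  also have "\<dots> \<le> ennreal ((e / 2)\<^sup>2)"
    using R[of 1] ri[of 1] by (intro nn_integral_real_cond_exp_square_le) (auto simp: r_def)
  finally show ?thesis .
qed

subsection \<open>Conditional scores\<close>

text \<open>True without differentiability, because \<open>DERIV_shift\<close> makes the two
  predicates from which \<open>deriv\<close> chooses equivalent.\<close>

lemma deriv_shift_add: "deriv (\<lambda>s. F (t + s)) s = deriv F (t + s)" for F :: "real \<Rightarrow> real"
  unfolding deriv_def using DERIV_shift[of F _ s t] by (simp add: add.commute)

text \<open>All base points on one line share the function \<open>F\<close>, so Gateaux derivatives
  there are ordinary derivatives of \<open>F\<close> at \<open>t\<close>. The direction is reversed
  in the last claim because the nuisance error is defined with the direction opposite to that of the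
  expansion; a second derivative is even in its direction.\<close>

lemma gateaux2_exists_lineD:
  fixes T :: "('w \<Rightarrow> 'v::real_vector) \<Rightarrow> real"
  assumes ex: "gateaux2_exists T (line_fun f h t) h"
  defines "F \<equiv> (\<lambda>s. T (line_fun f h s))"
  shows "(F has_real_derivative deriv F t) (at t)"
    and "(deriv F has_real_derivative deriv (deriv F) t) (at t)"
    and "gateaux2 T (line_fun f h t) (\<lambda>w. - h w) = deriv (deriv F) t"
proof -
  have line: "line_fun (line_fun f h t) h s = line_fun f h (t + s)"
    and line_neg: "line_fun (line_fun f h t) (\<lambda>w. - h w) s = line_fun f h (t - s)" for s
    by (auto simp: line_fun_def scaleR_add_left scaleR_diff_left)
  have ev: "\<forall>\<^sub>F s in nhds 0. (\<lambda>s. F (t + s)) field_differentiable at s"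
    and d2: "(\<lambda>s. deriv F (t + s)) field_differentiable at 0"
    using ex unfolding gateaux2_exists_def line F_def[symmetric]
    by (simp_all add: F_def deriv_shift_add[symmetric])
  have d1: "(F has_real_derivative deriv F (t + s)) (at (t + s))"
    if diff: "(\<lambda>s. F (t + s)) field_differentiable at s" for s
  proof -
    obtain D where "((\<lambda>s. F (t + s)) has_real_derivative D) (at s)"
      using diff by (auto simp: field_differentiable_def)
    then have "(F has_real_derivative D) (at (t + s))"
      using DERIV_shift[of F D s t] by (simp add: add.commute)
    then show ?thesis using DERIV_imp_deriv by blast
  qed
  show "(F has_real_derivative deriv F t) (at t)"
    using d1[OF eventually_nhds_x_imp_x[OF ev]] by simp
  obtain D where "((\<lambda>s. deriv F (t + s)) has_real_derivative D) (at 0)"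
    using d2 by (auto simp: field_differentiable_def)
  then have "(deriv F has_real_derivative D) (at t)"
    using DERIV_shift[of "deriv F" D 0 t] by (simp add: add.commute)
  then show D2: "(deriv F has_real_derivative deriv (deriv F) t) (at t)"
    using DERIV_imp_deriv by blast
  \<comment> \<open>To be differentiated once more, the derivative of the reflected function must be
    known on a neighbourhood of 0, so differentiability near 0 is transported along
    negation.\<close>
  have "\<forall>\<^sub>F s in nhds (0::real). deriv (\<lambda>s. F (t - s)) s = - deriv F (t - s)"
  proof -
    have "filterlim uminus (nhds 0) (nhds (0::real))"
      using filterlim_ident[of "nhds (0::real)"] tendsto_minus[of "\<lambda>x. x" 0 "nhds (0::real)"] by simp
    from eventually_compose_filterlim[OF ev this] show ?thesis
    proof eventually_elim
      case (elim s)
      have "((\<lambda>s. F (t - s)) has_real_derivative deriv F (t - s) * (-1)) (at s)"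
        using d1[OF elim] by (intro DERIV_chain2[of F]) (auto intro!: derivative_eq_intros)
      then show ?case using DERIV_imp_deriv by fastforce
    qed
  qed
  then have "deriv (deriv (\<lambda>s. F (t - s))) 0 = deriv (\<lambda>s. - deriv F (t - s)) 0"
    by (intro deriv_cong_ev) auto
  also have "((\<lambda>s. - deriv F (t - s)) has_real_derivative - (deriv (deriv F) t * (-1))) (at 0)"
    using D2 by (intro DERIV_minus DERIV_chain2[of "deriv F"]) (auto intro!: derivative_eq_intros)
  then have "deriv (\<lambda>s. - deriv F (t - s)) 0 = deriv (deriv F) t"
    using DERIV_imp_deriv by fastforce
  finally show "gateaux2 T (line_fun f h t) (\<lambda>w. - h w) = deriv (deriv F) t"
    unfolding gateaux2_def line_neg by (simp add: F_def)
qed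

lemma line_fun_mem_fun_segment:
  assumes "t \<in> {0..1}"
  shows "line_fun h (\<lambda>w. g w - h w) t \<in> fun_segment MW g h"
  unfolding fun_segment_def line_fun_def using assms
  by (auto intro!: exI[of _ "\<lambda>_. t"] simp: algebra_simps)

lemma diff_under_cond_meanD:
  assumes P: "prob_space P" and \<kappa>: "regular_cond_dist P Y N \<kappa>"
    and F: "diff_under_cond_mean P Y N \<kappa> F"
  shows "AE z in P. \<forall>\<nu>. integrable (\<kappa> (Y z)) (F \<nu>) \<and>
      ((\<lambda>v. cond_mean \<kappa> (F v) (Y z)) has_real_derivative
        cond_mean \<kappa> (\<lambda>z. deriv (\<lambda>v. F v z) \<nu>) (Y z)) (at \<nu>)"
    and "F \<nu> \<in> borel_measurable P"
    and "(\<lambda>z. deriv (\<lambda>v. F v z) \<nu>) \<in> borel_measurable P"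
proof -
  interpret prob_space P by fact
  note D = regular_cond_distD[OF \<kappa>]
  have *: "AE z in P. \<forall>\<nu>. integrable (\<kappa> (Y z)) (F \<nu>) \<and>
        integrable (\<kappa> (Y z)) (\<lambda>z. deriv (\<lambda>v. F v z) \<nu>) \<and>
        ((\<lambda>v. cond_mean \<kappa> (F v) (Y z)) has_real_derivative
          cond_mean \<kappa> (\<lambda>z. deriv (\<lambda>v. F v z) \<nu>) (Y z)) (at \<nu>)"
    using F unfolding diff_under_cond_mean_def by (rule AE_distrD[OF D(1)])
  then show "AE z in P. \<forall>\<nu>. integrable (\<kappa> (Y z)) (F \<nu>) \<and>
      ((\<lambda>v. cond_mean \<kappa> (F v) (Y z)) has_real_derivative
        cond_mean \<kappa> (\<lambda>z. deriv (\<lambda>v. F v z) \<nu>) (Y z)) (at \<nu>)"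
    by eventually_elim simp
  \<comment> \<open>A single \<open>z\<close> with integrability under \<open>\<kappa> (Y z)\<close>
    gives measurability for \<open>P\<close>, since both measures have the same
    sigma-algebra.\<close>
  have "\<exists>z\<in>space P. \<forall>\<nu>. integrable (\<kappa> (Y z)) (F \<nu>) \<and>
        integrable (\<kappa> (Y z)) (\<lambda>z. deriv (\<lambda>v. F v z) \<nu>)"
  proof (rule ccontr)
    assume "\<not> ?thesis"
    then have "AE z in P. \<not> (\<forall>\<nu>. integrable (\<kappa> (Y z)) (F \<nu>) \<and>
        integrable (\<kappa> (Y z)) (\<lambda>z. deriv (\<lambda>v. F v z) \<nu>))"
      by (intro AE_I2) blast
    with * have "AE z in P. False" by eventually_elim blast
    then show False by simp
  qed
  then obtain z where z: "z \<in> space P" "integrable (\<kappa> (Y z)) (F \<nu>)"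
      "integrable (\<kappa> (Y z)) (\<lambda>z. deriv (\<lambda>v. F v z) \<nu>)"
    by blast
  have "borel_measurable (\<kappa> (Y z)) = (borel_measurable P :: ('a \<Rightarrow> real) set)"
    by (rule measurable_cong_sets[OF D(5)[OF z(1)] refl])
  then show "F \<nu> \<in> borel_measurable P" "(\<lambda>z. deriv (\<lambda>v. F v z) \<nu>) \<in> borel_measurable P"
    using z(2,3)[THEN borel_measurable_integrable] by auto
qed

text \<open>The argument \<open>\<phi> (X z)\<close> is a function of the conditioning variable.
  Under almost every \<open>\<kappa> (Y z)\<close> it is therefore almost surely constant and may be
  frozen at its value.\<close>

lemma cond_score_eq_cond_mean:
  assumes P: "prob_space P" and \<kappa>: "regular_cond_dist P Y N \<kappa>" and h: "h \<in> borel_measurable N"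
    and \<phi>: "\<And>z. \<phi> (X z) = h (Y z)"
    and m: "\<And>\<nu>. d_loss l \<nu> f \<in> borel_measurable P" "(\<lambda>z. d_loss l (\<phi> (X z)) f z) \<in> borel_measurable P"
  shows "AE z in P. cond_score X \<kappa> l \<phi> f (Y z) = cond_mean \<kappa> (d_loss l (h (Y z)) f) (Y z)"
  using regular_cond_dist_concentrated[OF P \<kappa> h] AE_space
proof eventually_elim
  case (elim z)
  have "borel_measurable (\<kappa> (Y z)) = (borel_measurable P :: ('a \<Rightarrow> real) set)"
    by (rule measurable_cong_sets[OF regular_cond_distD(5)[OF \<kappa> elim(2)] refl])
  moreover have "AE z' in \<kappa> (Y z). d_loss l (\<phi> (X z')) f z' = d_loss l (h (Y z)) f z'"
    using elim(1) by eventually_elim (simp add: \<phi>)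
  ultimately show ?case
    unfolding cond_score_def cond_mean_def using m by (intro integral_cong_AE) auto
qed

text \<open>Multiplying by the sign of \<open>\<delta>\<close>, which is \<open>F\<close>-measurable, turns the two-sided bound into
  one that survives conditioning; integrability of \<open>\<delta>\<close> comes from the lower bound.\<close>

lemma cond_exp_increment_bounds:
  fixes p q \<delta> :: "'a \<Rightarrow> real"
  assumes M: "prob_space M" and G: "subalgebra M G" and F: "subalgebra G F"
    and p: "integrable M p" and q: "integrable M q"
    and \<delta>: "\<delta> \<in> borel_measurable F" and \<alpha>: "0 < \<alpha>"
    and pos: "AE z in M. 0 \<le> \<delta> z \<longrightarrow>
      \<alpha> * \<delta> z \<le> real_cond_exp M G p z - real_cond_exp M G q z \<and>
      real_cond_exp M G p z - real_cond_exp M G q z \<le> \<beta> * \<delta> z"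
    and neg: "AE z in M. \<delta> z \<le> 0 \<longrightarrow>
      \<beta> * \<delta> z \<le> real_cond_exp M G p z - real_cond_exp M G q z \<and>
      real_cond_exp M G p z - real_cond_exp M G q z \<le> \<alpha> * \<delta> z"
  shows "AE z in M. \<alpha> * \<bar>\<delta> z\<bar> \<le> \<bar>real_cond_exp M F p z - real_cond_exp M F q z\<bar> \<and>
    \<bar>real_cond_exp M F p z - real_cond_exp M F q z\<bar> \<le> \<beta> * \<bar>\<delta> z\<bar>"
proof -
  interpret prob_space M by fact
  have MF: "subalgebra M F" using G F by (auto simp: subalgebra_def)
  interpret G: finite_measure_subalgebra M G by unfold_locales fact
  interpret F: finite_measure_subalgebra M F by unfold_locales fact
  define m where "m z = real_cond_exp M G p z - real_cond_exp M G q z" for z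
  define s where "s z = (if 0 \<le> \<delta> z then 1 else -1 :: real)" for z
  have sF [measurable]: "s \<in> borel_measurable F" unfolding s_def[abs_def] using \<delta> by measurable
  have [measurable]: "s \<in> borel_measurable M" "\<delta> \<in> borel_measurable M"
    by (rule measurable_from_subalg[OF MF sF], rule measurable_from_subalg[OF MF \<delta>])
  have mi: "integrable M m"
    unfolding m_def using p q by (intro Bochner_Integration.integrable_diff G.real_cond_exp_int)
  then have [measurable]: "m \<in> borel_measurable M" by auto
  have smi: "integrable M (\<lambda>z. s z * m z)"
    using mi by (rule Bochner_Integration.integrable_bound) (auto simp: s_def abs_mult)
  have b: "AE z in M. \<alpha> * \<bar>\<delta> z\<bar> \<le> s z * m z \<and> s z * m z \<le> \<beta> * \<bar>\<delta> z\<bar>"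
    using pos neg by eventually_elim (auto simp: m_def s_def)
  have "AE z in M. norm (\<alpha> * \<bar>\<delta> z\<bar>) \<le> norm (s z * m z)"
    using b
  proof eventually_elim
    case (elim z)
    have "norm (\<alpha> * \<bar>\<delta> z\<bar>) = \<alpha> * \<bar>\<delta> z\<bar>" using \<alpha> by (simp add: abs_mult)
    also have "\<dots> \<le> norm (s z * m z)"
      using elim unfolding real_norm_def by (rule order_trans[OF conjunct1 abs_ge_self])
    finally show ?case .
  qed
  then have "integrable M (\<lambda>z. \<alpha> * \<bar>\<delta> z\<bar>)"
    using smi by (intro Bochner_Integration.integrable_bound[OF smi]) auto
  then have \<delta>i: "integrable M (\<lambda>z. \<bar>\<delta> z\<bar>)" using \<alpha> by simp
  have cm: "AE z in M. real_cond_exp M F (\<lambda>z. c * \<bar>\<delta> z\<bar>) z = c * \<bar>\<delta> z\<bar>" for c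
    using \<delta>i \<delta> by (intro F.real_cond_exp_F_meas) auto
  have "AE z in M. real_cond_exp M F (\<lambda>z. s z * m z) z = s z * real_cond_exp M F m z"
    using smi by (intro F.real_cond_exp_mult) auto
  moreover have "AE z in M. real_cond_exp M F m z
      = real_cond_exp M F (real_cond_exp M G p) z - real_cond_exp M F (real_cond_exp M G q) z"
    unfolding m_def using p q by (intro F.real_cond_exp_diff G.real_cond_exp_int)
  moreover have "AE z in M. real_cond_exp M F (real_cond_exp M G p) z = real_cond_exp M F p z"
    by (rule F.real_cond_exp_nested_subalg[OF G F p])
  moreover have "AE z in M. real_cond_exp M F (real_cond_exp M G q) z = real_cond_exp M F q z"
    by (rule F.real_cond_exp_nested_subalg[OF G F q])
  moreover have "AE z in M. real_cond_exp M F (\<lambda>z. \<alpha> * \<bar>\<delta> z\<bar>) z \<le> real_cond_exp M F (\<lambda>z. s z * m z) z"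
    using b \<delta>i smi by (intro F.real_cond_exp_mono) auto
  moreover have "AE z in M. real_cond_exp M F (\<lambda>z. s z * m z) z \<le> real_cond_exp M F (\<lambda>z. \<beta> * \<bar>\<delta> z\<bar>) z"
    using b \<delta>i smi by (intro F.real_cond_exp_mono) auto
  moreover note cm[of \<alpha>] cm[of \<beta>]
  ultimately show ?thesis
  proof eventually_elim
    case (elim z)
    define x where "x = real_cond_exp M F p z - real_cond_exp M F q z"
    have x: "\<alpha> * \<bar>\<delta> z\<bar> \<le> s z * x" "s z * x \<le> \<beta> * \<bar>\<delta> z\<bar>"
      using elim by (auto simp: x_def)
    \<comment> \<open>As \<open>s z\<close> is 1 or -1, nonnegativity identifies the product with
      \<open>\<bar>x\<bar>\<close>.\<close>
    have "0 \<le> s z * x"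
      by (rule order_trans[OF _ x(1)]) (use \<alpha> in simp)
    then have "s z * x = \<bar>x\<bar>" by (auto simp: s_def split: if_splits)
    then show ?case using x unfolding x_def by simp
  qed
qed

text \<open>For a common \<open>\<eta>\<close> the two losses differ by a term linear in
  \<open>\<nu>\<close>, whose slope is the difference of the corrections.\<close>

lemma d_loss_corrected_diff:
  assumes l: "l = corrected_loss l0 Corr" and d: "twice_differentiable_loss P G l"
    and G: "pair_fun \<eta> \<zeta>1 \<in> G" and z: "z \<in> space P"
  shows "d_loss l \<nu> (pair_fun \<eta> \<zeta>2) z
    = d_loss l \<nu> (pair_fun \<eta> \<zeta>1) z + (Corr (pair_fun \<eta> \<zeta>1) z - Corr (pair_fun \<eta> \<zeta>2) z)"
proof -
  let ?c = "Corr (pair_fun \<eta> \<zeta>1) z - Corr (pair_fun \<eta> \<zeta>2) z"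
  have fst: "fst \<circ> pair_fun \<eta> \<zeta>1 = \<eta>" "fst \<circ> pair_fun \<eta> \<zeta>2 = \<eta>"
    by (auto simp: pair_fun_def)
  have "(\<lambda>v. l v (pair_fun \<eta> \<zeta>2) z) = (\<lambda>v. l v (pair_fun \<eta> \<zeta>1) z + v * ?c)"
    by (simp add: l corrected_loss_def fst algebra_simps)
  moreover have "((\<lambda>v. l v (pair_fun \<eta> \<zeta>1) z) has_real_derivative d_loss l \<nu> (pair_fun \<eta> \<zeta>1) z) (at \<nu>)"
    using d G z by (simp add: twice_differentiable_loss_def d_loss_def DERIV_deriv_iff_field_differentiable)
  then have "((\<lambda>v. l v (pair_fun \<eta> \<zeta>1) z + v * ?c) has_real_derivative
      d_loss l \<nu> (pair_fun \<eta> \<zeta>1) z + 1 * ?c) (at \<nu>)"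
    by (intro DERIV_add DERIV_cmult_right DERIV_ident)
  ultimately show ?thesis
    unfolding d_loss_def[of l \<nu> "pair_fun \<eta> \<zeta>2"] using DERIV_imp_deriv by fastforce
qed

text \<open>The scores differ by corrections with conditional mean zero given \<open>X\<close>,
  hence also given any coarser \<open>F\<close> by the tower property. This makes the calibration
  error at \<open>\<eta>0\<close> independent of \<open>\<zeta>\<close> and carries the optimality
  of \<open>\<gamma>\<close> from one \<open>\<zeta>\<close> to another.\<close>

lemma real_cond_exp_d_loss_pair_fun_cong:
  assumes P: "prob_space P" and KX: "regular_cond_dist P X MX KX"
    and l: "l = corrected_loss l0 Corr" and d: "twice_differentiable_loss P G l"
    and Corr: "centred_correction P X MX KX G \<eta> Corr"
    and F: "subalgebra (vimage_algebra (space P) X MX) F"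
    and G: "pair_fun \<eta> \<zeta>1 \<in> G" "pair_fun \<eta> \<zeta>2 \<in> G"
    and i: "integrable P (\<lambda>z. d_loss l (\<phi> (X z)) (pair_fun \<eta> \<zeta>1) z)"
  shows "AE z in P. real_cond_exp P F (\<lambda>z. d_loss l (\<phi> (X z)) (pair_fun \<eta> \<zeta>2) z) z
    = real_cond_exp P F (\<lambda>z. d_loss l (\<phi> (X z)) (pair_fun \<eta> \<zeta>1) z) z"
proof -
  interpret prob_space P by fact
  note sX = subalgebra_vimage_algebra[OF regular_cond_distD(1)[OF KX]]
  have "subalgebra P F" using sX F by (auto simp: subalgebra_def)
  then interpret F: finite_measure_subalgebra P F by unfold_locales
  interpret X: finite_measure_subalgebra P "vimage_algebra (space P) X MX"
    by unfold_locales (rule sX)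
  have Ci: "integrable P (Corr (pair_fun \<eta> \<zeta>))"
    and C0: "AE x in distr P MX X. cond_mean KX (Corr (pair_fun \<eta> \<zeta>)) x = 0"
    if "pair_fun \<eta> \<zeta> \<in> G" for \<zeta>
    using Corr that by (auto simp: centred_correction_def)
  have zero: "AE z in P. real_cond_exp P F (Corr (pair_fun \<eta> \<zeta>)) z = 0"
    if "pair_fun \<eta> \<zeta> \<in> G" for \<zeta>
  proof -
    have "AE z in P. real_cond_exp P (vimage_algebra (space P) X MX) (Corr (pair_fun \<eta> \<zeta>)) z = 0"
      using AE_distrD[OF regular_cond_distD(1)[OF KX] C0[OF that]]
        cond_mean_eq_real_cond_exp[OF P KX Ci[OF that]]
      by eventually_elim simp
    then have "AE z in P. real_cond_exp P F (real_cond_exp P (vimage_algebra (space P) X MX) (Corr (pair_fun \<eta> \<zeta>))) z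
        = real_cond_exp P F (\<lambda>_. 0) z"
      by (intro F.real_cond_exp_cong) auto
    moreover have "AE z in P. real_cond_exp P F (\<lambda>_. 0) z = 0"
      by (intro F.real_cond_exp_F_meas) auto
    moreover note F.real_cond_exp_nested_subalg[OF sX F Ci[OF that]]
    ultimately show ?thesis by eventually_elim simp
  qed
  let ?p = "\<lambda>z. d_loss l (\<phi> (X z)) (pair_fun \<eta> \<zeta>1) z"
  let ?c = "\<lambda>z. Corr (pair_fun \<eta> \<zeta>1) z - Corr (pair_fun \<eta> \<zeta>2) z"
  have ci: "integrable P ?c" using Ci G by (intro Bochner_Integration.integrable_diff)
  have eq: "d_loss l (\<phi> (X z)) (pair_fun \<eta> \<zeta>2) z = ?p z + ?c z" if "z \<in> space P" for z
    by (rule d_loss_corrected_diff[OF l d G(1) that])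
  have "(\<lambda>z. d_loss l (\<phi> (X z)) (pair_fun \<eta> \<zeta>2) z) \<in> borel_measurable P"
    using i ci by (subst measurable_cong[OF eq]) auto
  then have "AE z in P. real_cond_exp P F (\<lambda>z. d_loss l (\<phi> (X z)) (pair_fun \<eta> \<zeta>2) z) z
    = real_cond_exp P F (\<lambda>z. ?p z + ?c z) z"
    using i ci eq by (intro F.real_cond_exp_cong) auto
  moreover have "AE z in P. real_cond_exp P F (\<lambda>z. ?p z + ?c z) z
      = real_cond_exp P F ?p z + real_cond_exp P F ?c z"
    using i ci by (intro F.real_cond_exp_add)
  moreover have "AE z in P. real_cond_exp P F ?c z
      = real_cond_exp P F (Corr (pair_fun \<eta> \<zeta>1)) z - real_cond_exp P F (Corr (pair_fun \<eta> \<zeta>2)) z"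
    using Ci G by (intro F.real_cond_exp_diff)
  moreover note zero[OF G(1)] zero[OF G(2)]
  ultimately show ?thesis by eventually_elim simp
qed

text \<open>The first-order condition at a minimiser. As \<open>\<gamma>\<close> is a function of
  \<open>\<theta>\<close>, it is frozen inside the conditional mean, which is then differentiated in
  \<open>\<nu>\<close> under the integral.\<close>

lemma calibration_fun_cond_score_zero:
  assumes P: "prob_space P" and X: "X \<in> P \<rightarrow>\<^sub>M MX"
    and K: "regular_cond_dist P (\<theta> \<circ> X) borel (K \<theta>)"
    and cal: "calibration_fun P X MX K l \<theta> f \<gamma>"
    and diff: "diff_under_cond_mean P (\<theta> \<circ> X) borel (K \<theta>) (\<lambda>\<nu>. l \<nu> f)"
    and i: "integrable P (\<lambda>z. d_loss l (\<gamma> (X z)) f z)"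
  shows "AE z in P. cond_score X (K \<theta>) l \<gamma> f (\<theta> (X z)) = 0"
proof -
  obtain c where c: "c \<in> borel_measurable borel" "\<gamma> = c \<circ> \<theta>"
    and min: "AE x in distr P MX X.
        is_arg_min (\<lambda>\<nu>. cond_mean (K \<theta>) (l \<nu> f) (\<theta> x)) (\<lambda>_. True) (\<gamma> x)"
    using cal by (auto simp: calibration_fun_def)
  note D = diff_under_cond_meanD[OF P K diff]
  have dm: "d_loss l \<nu> f \<in> borel_measurable P" for \<nu>
    using D(3)[of \<nu>] by (simp add: d_loss_def[abs_def])
  have "AE z in P. cond_score X (K \<theta>) l \<gamma> f ((\<theta> \<circ> X) z)
      = cond_mean (K \<theta>) (d_loss l (c ((\<theta> \<circ> X) z)) f) ((\<theta> \<circ> X) z)"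
    by (rule cond_score_eq_cond_mean[OF P K c(1)]) (use c i dm in auto)
  then show ?thesis using AE_distrD[OF X min] D(1)
  proof eventually_elim
    case (elim z)
    let ?r = "\<theta> (X z)"
    have "((\<lambda>v. cond_mean (K \<theta>) (l v f) ?r) has_real_derivative
        cond_mean (K \<theta>) (d_loss l (c ?r) f) ?r) (at (c ?r))"
      using elim(3) by (simp add: d_loss_def[abs_def])
    moreover have "cond_mean (K \<theta>) (l (c ?r) f) ?r \<le> cond_mean (K \<theta>) (l v f) ?r" for v
      using elim(2) by (simp add: is_arg_min_linorder c(2))
    ultimately have "cond_mean (K \<theta>) (d_loss l (c ?r) f) ?r = 0"
      by (intro DERIV_local_min[of _ _ _ 1]) auto
    then show ?case using elim(1) by simp
  qed
qed

text \<open>The quantifiers over \<open>a\<close> and \<open>b\<close> stand inside the almost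
  everywhere statement, so the random points \<open>\<theta> (X z)\<close> and
  \<open>\<gamma> (X z)\<close> can be inserted later. The upper bound is the lower one for the
  negated score with constant \<open>- \<beta>\<close>.\<close>

lemma AE_cond_score_increment_bounds:
  assumes P: "prob_space P" and KX: "regular_cond_dist P X MX KX"
    and diff: "diff_under_cond_mean P X MX KX (\<lambda>\<nu>. d_loss l \<nu> f)"
    and f: "f \<in> G" and conv: "strongly_convex_loss P X MX KX G l \<alpha>"
    and smooth: "smooth_loss P X MX KX G l \<beta>"
  shows "AE z in P. \<forall>a b. a \<le> b \<longrightarrow>
    \<alpha> * (b - a) \<le> cond_mean KX (d_loss l b f) (X z) - cond_mean KX (d_loss l a f) (X z) \<and>
    cond_mean KX (d_loss l b f) (X z) - cond_mean KX (d_loss l a f) (X z) \<le> \<beta> * (b - a)"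
proof -
  interpret prob_space P by fact
  note D = diff_under_cond_meanD[OF P KX diff, folded d2_loss_def]
  note X = regular_cond_distD(1)[OF KX]
  let ?S = "\<lambda>v z. cond_mean KX (d_loss l v f) (X z)"
  let ?D = "\<lambda>v z. cond_mean KX (d2_loss l v f) (X z)"
  have S: "?S v \<in> borel_measurable P" for v
    by (rule borel_measurable_cond_mean[OF KX D(2)])
  have "AE z in P. \<forall>a b. a \<le> b \<longrightarrow> \<alpha> * (b - a) \<le> ?S b z - ?S a z"
  proof (rule AE_increment_ge[where D="?D", OF sigma_finite_measure_axioms S])
    show "AE z in P. \<forall>v. ((\<lambda>v. ?S v z) has_real_derivative ?D v z) (at v)"
      using D(1) by eventually_elim simp
    show "AE z in P. \<alpha> \<le> ?D v z" for v
      using conv f unfolding strongly_convex_loss_def by (intro AE_distrD[OF X]) auto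
  qed
  moreover have "AE z in P. \<forall>a b. a \<le> b \<longrightarrow> - \<beta> * (b - a) \<le> - ?S b z - - ?S a z"
  proof (rule AE_increment_ge[where D="\<lambda>v z. - ?D v z" and S="\<lambda>v z. - ?S v z", OF sigma_finite_measure_axioms])
    show "(\<lambda>z. - ?S v z) \<in> borel_measurable P" for v using S[of v] by simp
    show "AE z in P. \<forall>v. ((\<lambda>v. - ?S v z) has_real_derivative - ?D v z) (at v)"
      using D(1) by eventually_elim (auto intro!: DERIV_minus)
    have "AE z in P. ?D v z \<le> \<beta>" for v
      using smooth f unfolding smooth_loss_def by (intro AE_distrD[OF X]) auto
    then show "AE z in P. - \<beta> \<le> - ?D v z" for v by simp
  qed
  ultimately show ?thesis
  proof eventually_elim
    case (elim z)
    show ?case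
    proof (intro allI impI conjI)
      fix a b :: real assume "a \<le> b"
      then show "\<alpha> * (b - a) \<le> ?S b z - ?S a z" using elim(1) by simp
      have "- (\<beta> * (b - a)) \<le> - ?S b z - - ?S a z"
        using elim(2)[rule_format, OF \<open>a \<le> b\<close>] by (simp only: mult_minus_left)
      then show "?S b z - ?S a z \<le> \<beta> * (b - a)" by linarith
    qed
  qed
qed

text \<open>Because the expansion keeps its remainder in integral form, only segment points with a constant
  weight \<open>t\<close> enter.  A mean value form would need a weight depending on \<open>x\<close>, which makes no sense
  for losses that depend on the nuisance as a whole function.\<close>

lemma cond_score_nuisance_square_le:
  fixes g g\<theta> :: "'w \<Rightarrow> 'v::real_vector"
  assumes P: "prob_space P" and KX: "regular_cond_dist P X MX KX"
    and K: "regular_cond_dist P (\<theta> \<circ> X) borel (K \<theta>)" and \<theta>: "\<theta> \<in> borel_measurable MX"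
    and seg: "fun_segment MW g g\<theta> \<subseteq> G"
    and int: "\<And>f. f \<in> G \<Longrightarrow> integrable P (\<lambda>z. d_loss l (\<gamma> (X z)) f z)"
    and ex: "gateaux2_exists_along P X MX KX G l \<gamma> g\<theta> (\<lambda>w. g w - g\<theta> w)"
    and orth: "AE r in distr P borel (\<theta> \<circ> X).
      has_gateaux_derivative (\<lambda>f. cond_score X (K \<theta>) l \<gamma> f r) g\<theta> (\<lambda>w. g w - g\<theta> w) 0"
    and zero: "AE z in P. real_cond_exp P (vimage_algebra (space P) (\<theta> \<circ> X) borel)
      (\<lambda>z. d_loss l (\<gamma> (X z)) g\<theta> z) z = 0"
    and e: "0 \<le> e" "nuisance_err P MW X KX l g g\<theta> \<gamma> \<le> ennreal e"
  shows "(\<integral>\<^sup>+z. ennreal ((real_cond_exp P (vimage_algebra (space P) (\<theta> \<circ> X) borel)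
      (\<lambda>z. d_loss l (\<gamma> (X z)) g z) z)\<^sup>2) \<partial>P) \<le> ennreal ((e / 2)\<^sup>2)"
proof -
  interpret prob_space P by fact
  note X = regular_cond_distD(1)[OF KX]
  define \<X> where "\<X> = vimage_algebra (space P) X MX"
  define \<T> where "\<T> = vimage_algebra (space P) (\<theta> \<circ> X) borel"
  have sX: "subalgebra P \<X>" unfolding \<X>_def by (rule subalgebra_vimage_algebra[OF X])
  have sT: "subalgebra \<X> \<T>"
    using subalgebra_vimage_algebra[of "\<theta> \<circ> X" \<X> borel] measurable_comp_vimage_algebra[OF X \<theta>]
    by (simp add: \<X>_def \<T>_def comp_def)
  interpret T: finite_measure_subalgebra P \<T>
    unfolding \<T>_def by (rule finite_measure_subalgebra_vimage[OF P regular_cond_distD(1)[OF K]])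
  interpret X: finite_measure_subalgebra P \<X> by unfold_locales (rule sX)
  define h where "h w = g w - g\<theta> w" for w
  have neg: "(\<lambda>w. g\<theta> w - g w) = (\<lambda>w. - h w)" by (simp add: h_def)
  define f where "f = line_fun g\<theta> h"
  have f01: "f 0 = g\<theta>" "f 1 = g" by (auto simp: f_def line_fun_def h_def)
  have fseg: "f t \<in> fun_segment MW g g\<theta>" if "t \<in> {0..1}" for t
    unfolding f_def h_def by (rule line_fun_mem_fun_segment[OF that])
  then have fG: "f t \<in> G" if "t \<in> {0..1}" for t using seg that by blast
  define p where "p t z = d_loss l (\<gamma> (X z)) (f t) z" for t z
  have p: "integrable P (p t)" if "t \<in> {0..1}" for t
    unfolding p_def by (rule int[OF fG[OF that]])
  define u where "u t z = cond_score X KX l \<gamma> (f t) (X z)" for t z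
  have u_mean: "u t z = cond_mean KX (p t) (X z)" for t z
    by (simp add: u_def p_def[abs_def] cond_score_def)
  have u_meas: "u t \<in> borel_measurable P" if "t \<in> {0..1}" for t
    unfolding u_mean[abs_def]
    by (rule borel_measurable_cond_mean[OF KX borel_measurable_integrable[OF p[OF that]]])
  have u_rce: "AE z in P. u t z = real_cond_exp P \<X> (p t) z" if "t \<in> {0..1}" for t
    unfolding u_mean \<X>_def by (rule cond_mean_eq_real_cond_exp[OF P KX p[OF that]])
  have u_int: "integrable P (u t)" if "t \<in> {0..1}" for t
    by (rule integrable_cong_AE_imp[OF X.real_cond_exp_int(1)[OF p[OF that]] u_meas[OF that]])
      (rule eventually_mono[OF u_rce[OF that]], rule sym)
  have u_T: "AE z in P. real_cond_exp P \<T> (u t) z = real_cond_exp P \<T> (p t) z" if "t \<in> {0..1}" for t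
  proof -
    have "AE z in P. real_cond_exp P \<T> (u t) z = real_cond_exp P \<T> (real_cond_exp P \<X> (p t)) z"
      using u_rce[OF that] u_meas[OF that] by (intro T.real_cond_exp_cong) auto
    with T.real_cond_exp_nested_subalg[OF sX sT p[OF that]] show ?thesis
      by eventually_elim simp
  qed
  define F where "F z s = cond_score X KX l \<gamma> (line_fun g\<theta> h s) (X z)" for z s
  have uF: "u s z = F z s" for s z by (simp add: u_def F_def f_def)
  have "AE z in P. \<forall>t. line_fun g\<theta> h t \<in> G \<longrightarrow>
      gateaux2_exists (\<lambda>f'. cond_score X KX l \<gamma> f' (X z)) (line_fun g\<theta> h t) h"
    using ex unfolding gateaux2_exists_along_def h_def[abs_def] by (rule AE_distrD[OF X])
  then have dd: "AE z in P. \<forall>t\<in>{0..1}. (F z has_real_derivative deriv (F z) t) (at t) \<and>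
      (deriv (F z) has_real_derivative deriv (deriv (F z)) t) (at t) \<and>
      gateaux2 (\<lambda>f'. cond_score X KX l \<gamma> f' (X z)) (f t) (\<lambda>w. g\<theta> w - g w) = deriv (deriv (F z)) t"
  proof eventually_elim
    case (elim z)
    show ?case
    proof
      fix t :: real assume "t \<in> {0..1}"
      then have "line_fun g\<theta> h t \<in> G" using fG by (simp add: f_def)
      then have "gateaux2_exists (\<lambda>f'. cond_score X KX l \<gamma> f' (X z)) (line_fun g\<theta> h t) h"
        using elim by blast
      note gateaux2_exists_lineD[OF this]
      moreover have "F z = (\<lambda>s. cond_score X KX l \<gamma> (line_fun g\<theta> h s) (X z))"
        by (simp add: F_def[abs_def])
      ultimately show "(F z has_real_derivative deriv (F z) t) (at t) \<and>
        (deriv (F z) has_real_derivative deriv (deriv (F z)) t) (at t) \<and>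
        gateaux2 (\<lambda>f'. cond_score X KX l \<gamma> f' (X z)) (f t) (\<lambda>w. g\<theta> w - g w) = deriv (deriv (F z)) t"
        unfolding neg f_def by metis
    qed
  qed
  \<comment> \<open>The point \<open>f t\<close> belongs to the segment with constant weight
    \<open>t\<close>, so its second derivative is among those in the supremum.\<close>
  have C: "(\<integral>\<^sup>+z. ennreal ((deriv (deriv (F z)) t)\<^sup>2) \<partial>P) \<le> ennreal (e\<^sup>2)" if t: "t \<in> {0..1}" for t
  proof -
    have *: "L2_norm P (\<lambda>z. gateaux2 (\<lambda>f'. cond_score X KX l \<gamma> f' (X z)) (f t) (\<lambda>w. g\<theta> w - g w)) \<le> ennreal e"
      using e(2) SUP_upper[OF fseg[OF t]] unfolding nuisance_err_def by (rule order_trans[rotated])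
    have "AE z in P. gateaux2 (\<lambda>f'. cond_score X KX l \<gamma> f' (X z)) (f t) (\<lambda>w. g\<theta> w - g w)
        = deriv (deriv (F z)) t"
      using dd by eventually_elim (use t in blast)
    from L2_norm_cong_AE[OF this] have "L2_norm P (\<lambda>z. deriv (deriv (F z)) t) \<le> ennreal e"
      using * by simp
    then show ?thesis by (simp only: L2_norm_le_iff[OF e(1)])
  qed
  have "\<exists>D\<in>borel_measurable P. \<forall>t\<in>{0..1}.
    (\<integral>\<^sup>+z. ennreal ((u t z - u 0 z - t * D z)\<^sup>2) \<partial>P) \<le> ennreal ((t\<^sup>2 / 2)\<^sup>2) * ennreal (e\<^sup>2)"
  proof (rule Taylor2_remainder_nn_integral_le[OF sigma_finite_measure_axioms u_meas _ C])
    show "AE z in P. \<forall>t\<in>{0..1}. ((\<lambda>s. u s z) has_real_derivative deriv (F z) t) (at t within {0..1}) \<and>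
      (deriv (F z) has_real_derivative deriv (deriv (F z)) t) (at t within {0..1})"
      using dd
    proof eventually_elim
      case (elim z)
      have "(\<lambda>s. u s z) = F z" by (simp add: uF)
      then show ?case using elim by (simp add: has_field_derivative_at_within)
    qed
  qed
  then obtain D where D: "D \<in> borel_measurable P" and R: "\<And>t. t \<in> {0..1} \<Longrightarrow>
    (\<integral>\<^sup>+z. ennreal ((u t z - u 0 z - t * D z)\<^sup>2) \<partial>P) \<le> ennreal ((t\<^sup>2 / 2)\<^sup>2) * ennreal (e\<^sup>2)"
    by blast
  have lim: "AE z in P. (\<lambda>n. (real_cond_exp P \<T> (u (1 / real (Suc n))) z - real_cond_exp P \<T> (u 0) z)
      * real (Suc n)) \<longlonglongrightarrow> 0"
  proof -
    \<comment> \<open>Orthogonality concerns the version of the conditional score built from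
      \<open>K \<theta>\<close>, which is identified here with the conditional expectation of
      \<open>u t\<close>. The countably many times \<open>1 / (n + 1)\<close> detect the derivative
      at 0, so one null set serves for all of them.\<close>
    have U: "AE z in P. real_cond_exp P \<T> (u t) z = cond_score X (K \<theta>) l \<gamma> (f t) (\<theta> (X z))"
      if "t \<in> {0..1}" for t
      using u_T[OF that] cond_mean_eq_real_cond_exp[OF P K p[OF that], folded \<T>_def]
      by eventually_elim (simp add: cond_score_def p_def[abs_def])
    have "AE z in P. \<forall>n. real_cond_exp P \<T> (u (1 / real (Suc n))) z
        = cond_score X (K \<theta>) l \<gamma> (f (1 / real (Suc n))) (\<theta> (X z))"
      unfolding AE_all_countable by (intro allI U) simp
    moreover have "AE z in P. real_cond_exp P \<T> (u 0) z = cond_score X (K \<theta>) l \<gamma> (f 0) (\<theta> (X z))"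
      by (rule U) simp
    moreover have "AE z in P. has_gateaux_derivative (\<lambda>f. cond_score X (K \<theta>) l \<gamma> f (\<theta> (X z))) g\<theta> h 0"
      using AE_distrD[OF regular_cond_distD(1)[OF K] orth] by (simp add: h_def[abs_def])
    ultimately show ?thesis
    proof eventually_elim
      case (elim z)
      have "((\<lambda>t. cond_score X (K \<theta>) l \<gamma> (f t) (\<theta> (X z))) has_real_derivative 0) (at 0 within {0..1})"
        using elim(3) unfolding has_gateaux_derivative_def f_def
        by (rule has_field_derivative_at_within)
      from has_real_derivative_right_LIMSEQ[OF this] show ?case
        unfolding elim(1)[rule_format] elim(2) by simp
    qed
  qed
  have "(\<integral>\<^sup>+z. ennreal ((real_cond_exp P \<T> (u 1) z)\<^sup>2) \<partial>P) \<le> ennreal ((e / 2)\<^sup>2)"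
  proof (rule T.orthogonal_cond_exp_square_le[OF u_int D e(1) _ lim])
    have "AE z in P. real_cond_exp P \<T> (p 0) z = 0"
      using zero unfolding \<T>_def p_def f01 .
    moreover have "AE z in P. real_cond_exp P \<T> (u 0) z = real_cond_exp P \<T> (p 0) z"
      by (rule u_T) simp
    ultimately show "AE z in P. real_cond_exp P \<T> (u 0) z = 0" by eventually_elim simp
    show "(\<integral>\<^sup>+z. ennreal ((u t z - u 0 z - t * D z)\<^sup>2) \<partial>P) \<le> ennreal ((t\<^sup>2 / 2 * e)\<^sup>2)"
      if "t \<in> {0..1}" for t
      using R[OF that] by (simp only: power_mult_distrib ennreal_mult[OF zero_le_power2 zero_le_power2])
  qed
  also have "(\<integral>\<^sup>+z. ennreal ((real_cond_exp P \<T> (u 1) z)\<^sup>2) \<partial>P)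
    = (\<integral>\<^sup>+z. ennreal ((real_cond_exp P \<T> (p 1) z)\<^sup>2) \<partial>P)"
  proof (rule nn_integral_cong_AE)
    show "AE z in P. ennreal ((real_cond_exp P \<T> (u 1) z)\<^sup>2) = ennreal ((real_cond_exp P \<T> (p 1) z)\<^sup>2)"
      by (rule eventually_mono[OF u_T[of 1]]) simp_all
  qed
  finally show ?thesis unfolding \<T>_def p_def f01 .
qed

text \<open>The left side is taken at an arbitrary admissible \<open>\<zeta>\<close>, and
  \<open>\<gamma>\<close> is any version of the true calibration function. The assumptions with
  \<open>diff_under_cond_mean\<close> permit differentiation under the conditional mean,
  integrability of the scores gives them conditional expectations, and the segment condition keeps
  the expansion inside \<open>G\<close>.\<close>

theorem theorem4p5:
  fixes P :: "'z measure" and MW :: "'w measure" and MX :: "'x measure"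
    and W :: "'z \<Rightarrow> 'w" and prX :: "'w \<Rightarrow> 'x" and X :: "'z \<Rightarrow> 'x"
    and KX :: "'x \<Rightarrow> 'z measure" and K :: "('x \<Rightarrow> real) \<Rightarrow> real \<Rightarrow> 'z measure"
    and G :: "('w \<Rightarrow> 'b::euclidean_space \<times> 'c::euclidean_space) set"
    and l0 :: "real \<Rightarrow> ('w \<Rightarrow> 'b) \<Rightarrow> 'z \<Rightarrow> real"
    and Corr :: "('w \<Rightarrow> 'b \<times> 'c) \<Rightarrow> 'z \<Rightarrow> real"
    and l :: "real \<Rightarrow> ('w \<Rightarrow> 'b \<times> 'c) \<Rightarrow> 'z \<Rightarrow> real"
    and \<eta>0 :: "'w \<Rightarrow> 'b" and \<alpha> \<beta> :: real
    and \<theta> \<gamma> :: "'x \<Rightarrow> real" and \<zeta>\<theta> :: "'x \<Rightarrow> 'c"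
    and g\<theta> g :: "'w \<Rightarrow> 'b \<times> 'c" and \<zeta> :: "'w \<Rightarrow> 'c"
  assumes "prob_space P"
    and "W \<in> P \<rightarrow>\<^sub>M MW" and "prX \<in> MW \<rightarrow>\<^sub>M MX" and "X = prX \<circ> W"
    and "regular_cond_dist P X MX KX"
    and "\<And>\<phi>. \<phi> \<in> borel_measurable MX \<Longrightarrow> regular_cond_dist P (\<phi> \<circ> X) borel (K \<phi>)"
    and "\<And>f. f \<in> G \<Longrightarrow> in_L2 (distr P MW W) f"
    and "l = corrected_loss l0 Corr"
    and "centred_correction P X MX KX G \<eta>0 Corr"
    and "twice_differentiable_loss P G l"
    and "conditionally_orthogonal P X MX prX K G l \<eta>0"
    and "\<alpha> > 0" and "\<beta> > 0"
    and "strongly_convex_loss P X MX KX G l \<alpha>"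
    and "smooth_loss P X MX KX G l \<beta>"
    and "\<theta> \<in> borel_measurable MX"
    and "orthogonal_at P X MX prX K G l \<eta>0 \<theta> \<zeta>\<theta>"
    and "g\<theta> = pair_fun \<eta>0 (\<zeta>\<theta> \<circ> prX)"
    and "true_calibration_fun P X MX K G l \<eta>0 \<theta> \<gamma>"
    and "\<And>f. f \<in> G \<Longrightarrow> diff_under_cond_mean P X MX KX (\<lambda>\<nu>. d_loss l \<nu> f)"
    and "\<And>f. f \<in> G \<Longrightarrow> diff_under_cond_mean P (\<theta> \<circ> X) borel (K \<theta>) (\<lambda>\<nu>. l \<nu> f)"
    and "\<And>f. f \<in> G \<Longrightarrow> integrable P (\<lambda>z. d_loss l (\<theta> (X z)) f z)"
    and "\<And>f. f \<in> G \<Longrightarrow> integrable P (\<lambda>z. d_loss l (\<gamma> (X z)) f z)"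
    and "\<And>f h. f \<in> G \<Longrightarrow> h \<in> G \<Longrightarrow> gateaux2_exists_along P X MX KX G l \<gamma> f (\<lambda>w. h w - g\<theta> w)"
    and "g \<in> G" and "fun_segment MW g g\<theta> \<subseteq> G"
    and "pair_fun \<eta>0 \<zeta> \<in> G"
  shows "cal_error P X K l \<theta> (pair_fun \<eta>0 \<zeta>)
    \<le> ennreal (\<beta> / (2 * \<alpha>)) * nuisance_err P MW X KX l g g\<theta> \<gamma>
      + ennreal (\<beta> / \<alpha>) * cal_error P X K l \<theta> g"
proof -
  note P = assms(1) and KX = assms(5) and l = assms(8) and Corr = assms(9) and diffl = assms(10)
    and \<alpha> = assms(12) and \<beta> = assms(13) and \<theta> = assms(16) and orth = assms(17) and g\<theta> = assms(18)
    and cal = assms(19) and dX = assms(20) and dT = assms(21) and i\<theta> = assms(22) and i\<gamma> = assms(23)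
    and g = assms(25) and seg = assms(26) and G\<zeta> = assms(27)
  interpret prob_space P by (rule P)
  note X = regular_cond_distD(1)[OF KX]
  note K = assms(6)[OF \<theta>]
  define \<X> where "\<X> = vimage_algebra (space P) X MX"
  define \<T> where "\<T> = vimage_algebra (space P) (\<theta> \<circ> X) borel"
  have sX: "subalgebra P \<X>" unfolding \<X>_def by (rule subalgebra_vimage_algebra[OF X])
  have sT: "subalgebra \<X> \<T>"
    using subalgebra_vimage_algebra[of "\<theta> \<circ> X" \<X> borel] measurable_comp_vimage_algebra[OF X \<theta>]
    by (simp add: \<X>_def \<T>_def comp_def)
  have G0: "pair_fun \<eta>0 (\<zeta>\<theta> \<circ> prX) \<in> G" using orth by (simp add: orthogonal_at_def)
  then have g\<theta>G: "g\<theta> \<in> G" unfolding g\<theta> .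
  obtain \<zeta>1 where G1: "pair_fun \<eta>0 \<zeta>1 \<in> G"
    and cal1: "calibration_fun P X MX K l \<theta> (pair_fun \<eta>0 \<zeta>1) \<gamma>"
    using cal by (auto simp: true_calibration_fun_def)
  obtain c where c: "c \<in> borel_measurable borel" "\<gamma> = c \<circ> \<theta>"
    using cal1 by (auto simp: calibration_fun_def)
  have \<gamma>: "\<gamma> \<in> borel_measurable MX" unfolding c(2) by (rule measurable_comp[OF \<theta> c(1)])
  define C where "C f = real_cond_exp P \<T> (\<lambda>z. d_loss l (\<theta> (X z)) f z)" for f
  define E where "E f = real_cond_exp P \<T> (\<lambda>z. d_loss l (\<gamma> (X z)) f z)" for f
  have [measurable]: "C f \<in> borel_measurable P" "E f \<in> borel_measurable P" for f
    by (auto simp: C_def E_def)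
  have cal_C: "cal_error P X K l \<theta> f = L2_norm P (C f)" if "f \<in> G" for f
    unfolding cal_error_def
    using cond_mean_eq_real_cond_exp[OF P K i\<theta>[OF that]]
    by (intro L2_norm_cong_AE) (simp add: C_def \<T>_def cond_score_def)
  have C_\<zeta>: "AE z in P. C (pair_fun \<eta>0 \<zeta>) z = C g\<theta> z"
    unfolding C_def g\<theta>
    by (rule real_cond_exp_d_loss_pair_fun_cong[OF P KX l diffl Corr sT[unfolded \<X>_def] G0 G\<zeta> i\<theta>[OF G0]])
  \<comment> \<open>The \<open>\<zeta>1\<close> for which \<open>\<gamma>\<close> is known to be
    optimal may differ from the \<open>\<zeta>\<theta>\<close> of orthogonality; the centred
    correction bridges the two.\<close>
  have E0: "AE z in P. E g\<theta> z = 0"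
  proof -
    have "AE z in P. E g\<theta> z = E (pair_fun \<eta>0 \<zeta>1) z"
      unfolding E_def g\<theta>
      by (rule real_cond_exp_d_loss_pair_fun_cong[OF P KX l diffl Corr sT[unfolded \<X>_def] G1 G0 i\<gamma>[OF G1]])
    with calibration_fun_cond_score_zero[OF P X K cal1 dT[OF G1] i\<gamma>[OF G1]]
      cond_mean_eq_real_cond_exp[OF P K i\<gamma>[OF G1]]
    show ?thesis by eventually_elim (simp add: E_def \<T>_def cond_score_def)
  qed
  \<comment> \<open>The difference \<open>\<theta> - \<gamma>\<close> is a function of
    \<open>\<theta>\<close>, so the bounds on score increments given \<open>X\<close> descend to
    conditioning on \<open>\<theta> (X z)\<close>.\<close>
  have incr: "AE z in P. \<alpha> * \<bar>\<theta> (X z) - \<gamma> (X z)\<bar> \<le> \<bar>C f z - E f z\<bar> \<and>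
      \<bar>C f z - E f z\<bar> \<le> \<beta> * \<bar>\<theta> (X z) - \<gamma> (X z)\<bar>" if f: "f \<in> G" for f
  proof -
    note dm = diff_under_cond_meanD(2)[OF P KX dX[OF f]]
    let ?S = "\<lambda>\<nu> z. cond_mean KX (d_loss l \<nu> f) (X z)"
    have frozen: "AE z in P. real_cond_exp P \<X> (\<lambda>z. d_loss l (\<phi> (X z)) f z) z = ?S (\<phi> (X z)) z"
      if \<phi>: "\<phi> \<in> borel_measurable MX" and i: "integrable P (\<lambda>z. d_loss l (\<phi> (X z)) f z)" for \<phi>
      using cond_score_eq_cond_mean[where l=l and f=f and \<phi>=\<phi> and X=X, OF P KX \<phi> refl dm borel_measurable_integrable[OF i]]
        cond_mean_eq_real_cond_exp[OF P KX i]
      by eventually_elim (simp add: cond_score_def \<X>_def)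
    note b = AE_cond_score_increment_bounds[OF P KX dX[OF f] f assms(14,15)]
    note fr = frozen[OF \<theta> i\<theta>[OF f]] frozen[OF \<gamma> i\<gamma>[OF f]]
    have \<delta>: "(\<lambda>z. \<theta> (X z) - \<gamma> (X z)) \<in> borel_measurable \<T>"
      using measurable_comp_vimage_algebra[OF regular_cond_distD(1)[OF K], of "\<lambda>r. r - c r" borel] c
      by (simp add: \<T>_def)
    show ?thesis
      unfolding C_def E_def
    proof (rule cond_exp_increment_bounds[OF P sX sT i\<theta>[OF f] i\<gamma>[OF f] \<delta> \<alpha>])
      show "AE z in P. 0 \<le> \<theta> (X z) - \<gamma> (X z) \<longrightarrow>
        \<alpha> * (\<theta> (X z) - \<gamma> (X z)) \<le> real_cond_exp P \<X> (\<lambda>z. d_loss l (\<theta> (X z)) f z) z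
          - real_cond_exp P \<X> (\<lambda>z. d_loss l (\<gamma> (X z)) f z) z \<and>
        real_cond_exp P \<X> (\<lambda>z. d_loss l (\<theta> (X z)) f z) z
          - real_cond_exp P \<X> (\<lambda>z. d_loss l (\<gamma> (X z)) f z) z \<le> \<beta> * (\<theta> (X z) - \<gamma> (X z))"
        using b fr by eventually_elim simp
      \<comment> \<open>Here \<open>\<gamma>\<close> is the right end of the increment, and the
        change of sign exchanges \<open>\<alpha>\<close> and \<open>\<beta>\<close>.\<close>
      show "AE z in P. \<theta> (X z) - \<gamma> (X z) \<le> 0 \<longrightarrow>
        \<beta> * (\<theta> (X z) - \<gamma> (X z)) \<le> real_cond_exp P \<X> (\<lambda>z. d_loss l (\<theta> (X z)) f z) z
          - real_cond_exp P \<X> (\<lambda>z. d_loss l (\<gamma> (X z)) f z) z \<and>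
        real_cond_exp P \<X> (\<lambda>z. d_loss l (\<theta> (X z)) f z) z
          - real_cond_exp P \<X> (\<lambda>z. d_loss l (\<gamma> (X z)) f z) z \<le> \<alpha> * (\<theta> (X z) - \<gamma> (X z))"
        using b fr
      proof eventually_elim
        case (elim z)
        show ?case
        proof
          assume "\<theta> (X z) - \<gamma> (X z) \<le> 0"
          then have "\<alpha> * (\<gamma> (X z) - \<theta> (X z)) \<le> ?S (\<gamma> (X z)) z - ?S (\<theta> (X z)) z"
            "?S (\<gamma> (X z)) z - ?S (\<theta> (X z)) z \<le> \<beta> * (\<gamma> (X z) - \<theta> (X z))"
            using elim(1) by auto
          then show "\<beta> * (\<theta> (X z) - \<gamma> (X z)) \<le> real_cond_exp P \<X> (\<lambda>z. d_loss l (\<theta> (X z)) f z) z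
              - real_cond_exp P \<X> (\<lambda>z. d_loss l (\<gamma> (X z)) f z) z \<and>
            real_cond_exp P \<X> (\<lambda>z. d_loss l (\<theta> (X z)) f z) z
              - real_cond_exp P \<X> (\<lambda>z. d_loss l (\<gamma> (X z)) f z) z \<le> \<alpha> * (\<theta> (X z) - \<gamma> (X z))"
            unfolding elim(2,3) right_diff_distrib by linarith
        qed
      qed
    qed
  qed
  \<comment> \<open>Smoothness is used at \<open>g\<theta>\<close>, where \<open>E\<close> vanishes,
    and strong convexity at \<open>g\<close>; the distance between \<open>\<theta>\<close> and
    \<open>\<gamma>\<close>, which does not depend on the nuisance, links the two and produces
    \<open>\<beta> / \<alpha>\<close>.\<close>
  have C_le: "AE z in P. \<bar>C (pair_fun \<eta>0 \<zeta>) z\<bar> \<le> \<beta> / \<alpha> * (\<bar>E g z\<bar> + \<bar>C g z\<bar>)"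
    using C_\<zeta> E0 incr[OF g\<theta>G] incr[OF g]
  proof eventually_elim
    case (elim z)
    let ?d = "\<bar>\<theta> (X z) - \<gamma> (X z)\<bar>"
    have "\<bar>C (pair_fun \<eta>0 \<zeta>) z\<bar> \<le> \<beta> * ?d" using elim by simp
    also have "\<alpha> * ?d \<le> \<bar>E g z\<bar> + \<bar>C g z\<bar>" using elim(4) by linarith
    then have "?d \<le> (\<bar>E g z\<bar> + \<bar>C g z\<bar>) / \<alpha>" using \<alpha> by (simp add: pos_le_divide_eq mult.commute)
    then have "\<beta> * ?d \<le> \<beta> * ((\<bar>E g z\<bar> + \<bar>C g z\<bar>) / \<alpha>)" using \<beta> by (intro mult_left_mono) auto
    finally show ?case by simp
  qed
  show ?thesis
  \<comment> \<open>Both coefficients are positive, so an infinite term makes the right side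
    infinite. Otherwise the two quantities are real numbers \<open>e\<close> and
    \<open>k\<close>.\<close>
  proof (cases "nuisance_err P MW X KX l g g\<theta> \<gamma> = \<infinity> \<or> cal_error P X K l \<theta> g = \<infinity>")
    case True
    then show ?thesis using \<alpha> \<beta> by (auto simp: ennreal_mult_top)
  next
    case False
    then obtain e k where e: "0 \<le> e" "nuisance_err P MW X KX l g g\<theta> \<gamma> = ennreal e"
      and k: "0 \<le> k" "cal_error P X K l \<theta> g = ennreal k"
      by (cases "nuisance_err P MW X KX l g g\<theta> \<gamma>" rule: ennreal_cases;
          cases "cal_error P X K l \<theta> g" rule: ennreal_cases) auto
    have Eg: "(\<integral>\<^sup>+z. ennreal ((E g z)\<^sup>2) \<partial>P) \<le> ennreal ((e / 2)\<^sup>2)"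
      unfolding E_def \<T>_def
    proof (rule cond_score_nuisance_square_le[where l=l and \<gamma>=\<gamma> and K=K, OF P KX K \<theta> seg i\<gamma>])
      show "gateaux2_exists_along P X MX KX G l \<gamma> g\<theta> (\<lambda>w. g w - g\<theta> w)"
        by (rule assms(24)[OF g\<theta>G g])
      show "AE r in distr P borel (\<theta> \<circ> X).
        has_gateaux_derivative (\<lambda>f. cond_score X (K \<theta>) l \<gamma> f r) g\<theta> (\<lambda>w. g w - g\<theta> w) 0"
        using orth cal g unfolding orthogonal_at_def g\<theta> by blast
      show "AE z in P. real_cond_exp P (vimage_algebra (space P) (\<theta> \<circ> X) borel)
        (\<lambda>z. d_loss l (\<gamma> (X z)) g\<theta> z) z = 0"
        using E0 unfolding E_def \<T>_def .
    qed (use e in auto)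
    have Cg: "(\<integral>\<^sup>+z. ennreal ((C g z)\<^sup>2) \<partial>P) \<le> ennreal (k\<^sup>2)"
      using L2_norm_le_iff[OF k(1), of P "C g"] k(2) cal_C[OF g] by simp
    let ?b = "\<beta> / \<alpha>"
    have bk: "0 \<le> ?b * (e / 2 + k)"
      using \<alpha> \<beta> e(1) k(1) by (intro mult_nonneg_nonneg) auto
    have "(\<integral>\<^sup>+z. ennreal ((C (pair_fun \<eta>0 \<zeta>) z)\<^sup>2) \<partial>P)
      \<le> (\<integral>\<^sup>+z. ennreal (?b\<^sup>2) * ennreal ((\<bar>E g z\<bar> + \<bar>C g z\<bar>)\<^sup>2) \<partial>P)"
    proof (rule nn_integral_mono_AE)
      show "AE z in P. ennreal ((C (pair_fun \<eta>0 \<zeta>) z)\<^sup>2) \<le> ennreal (?b\<^sup>2) * ennreal ((\<bar>E g z\<bar> + \<bar>C g z\<bar>)\<^sup>2)"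
        using C_le
      proof eventually_elim
        case (elim z)
        from power_mono[OF this, of 2] show ?case
          unfolding ennreal_mult[OF zero_le_power2 zero_le_power2, symmetric] power_mult_distrib
          by (intro ennreal_leI) simp
      qed
    qed
    also have "\<dots> = ennreal (?b\<^sup>2) * (\<integral>\<^sup>+z. ennreal ((\<bar>E g z\<bar> + \<bar>C g z\<bar>)\<^sup>2) \<partial>P)"
      by (rule nn_integral_cmult) measurable
    also have "\<dots> \<le> ennreal (?b\<^sup>2) * ennreal ((e / 2 + k)\<^sup>2)"
      using e(1) k(1) Eg Cg by (intro mult_left_mono Minkowski_nn_integral_square) auto
    also have "\<dots> = ennreal ((?b * (e / 2 + k))\<^sup>2)"
      unfolding power_mult_distrib by (rule ennreal_mult[symmetric]) auto
    finally have "cal_error P X K l \<theta> (pair_fun \<eta>0 \<zeta>) \<le> ennreal (?b * (e / 2 + k))"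
      unfolding cal_C[OF G\<zeta>] L2_norm_le_iff[OF bk] .
    \<comment> \<open>The half in front of \<open>e\<close>, the Taylor factor
      \<open>t^2 / 2\<close> at \<open>t = 1\<close>, accounts for the 2 in
      \<open>\<beta> / (2 * \<alpha>)\<close>.\<close>
    also have "?b * (e / 2 + k) = \<beta> / (2 * \<alpha>) * e + ?b * k"
      by (simp add: distrib_left add_divide_distrib mult.commute)
    also have "ennreal \<dots> = ennreal (\<beta> / (2 * \<alpha>)) * ennreal e + ennreal ?b * ennreal k"
      using \<alpha> \<beta> e(1) k(1) by (simp add: ennreal_plus flip: ennreal_mult)
    finally show ?thesis unfolding e(2) k(2) .
  qed
qed

end
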